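(* Let $\Omega\subset\mathbb R^{m+1}$ be open and let $F$ be an anisotropic (elliptic) integrand on $\Omega$. Let $(V_k)_k$ be a sequence of $m$-varifolds on $\Omega$ and let $h>0$ be such that for every $K\subset\subset\Omega$ $$\limsup_{k\to\infty}\ \sup\Big\{\delta_FV_k(X)-h\int\|X\|_{F^*,x}\,F(x,\nu)\,dV_k(x,\nu)\ :\ X\in C^1_c(\Omega,\mathbb R^{m+1}),\ |X|\le\mathbf 1_K\Big\}<\infty .$$ Then the area blow-up set $$Z:=\Big\{x\in\overline\Omega:\ \limsup_{k\to\infty}\|V_k\|(B_r(x))=+\infty\ \text{ for every } r>0\Big\}$$ is an $(m,h)$-set in $\Omega$ with respect to $F$ (that is, $Z\cap\Omega$ is an $(m,h)$-set).
   Context: Integrands. An anisotropic (elliptic) integrand on the open set $\Omega\subset\mathbb R^{m+1}$ is a positive $C^2$ function $F:\Omega\times(\mathbb R^{m+1}\setminus\{0\})\to(0,\infty)$ which is even, one-homogeneous and convex in the second variable, i.e. $F(x,\lambda\nu)=|\lambda|F(x,\nu)$ for $\lambda\neq0$ and $F(x,\nu_1+\nu_2)\le F(x,\nu_1)+F(x,\nu_2)$. $D_1F$, $D_2F$ are the differentials in the first and second variable; $F_i=\partial F/\partial\nu_i$, $F_{ij}=\partial^2F/\partial\nu_i\partial\nu_j$, $\partial_iF_j=\partial^2F/\partial x_i\partial\nu_j$; repeated indices are summed. The dual norm is $\|w\|_{F^*,x}=\sup\{\langle v,w\rangle: F(x,v)\le1\}$ (with $F(x,0)=0$). Varifolds.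 An $m$-varifold on $\Omega$ is a positive Radon measure $V$ on $\Omega\times\mathbb S^m$ ($\mathbb S^m$ the unit sphere of $\mathbb R^{m+1}$) which is even in the $\mathbb S^m$ variable: $V(A\times S)=V(A\times(-S))$. $\|V\|$ is its projection (push-forward) to $\Omega$; $B_r(x)$ is the open ball of radius $r$ and center $x$, and $\|V\|(B_r(x))$ means $\|V\|(B_r(x)\cap\Omega)$. The anisotropic first variation is, for $g\in C^1_c(\Omega,\mathbb R^{m+1})$, $$\delta_FV(g)=\int\big[\langle D_1F(x,\nu),g(x)\rangle+B_F(x,\nu):Dg(x)\big]dV(x,\nu),\qquad B_F(x,\nu)=F(x,\nu)\,\mathrm{Id}-\nu\otimes D_2F(x,\nu),$$ where $A:B=\operatorname{tr}(A^*B)$ and $(Dg)_{ij}=\partial_jg_i$; it equals the derivative at $t=0$ of the energy $\int F\,dV$ under push-forward by $x\mapsto x+tg(x)$. $(m,h)$-sets. A relatively closed set $Z\subset\Omega$ is an $(m,h)$-set in $\Omega$ with respect to $F$ if: whenever $f:\Omega\to\mathbb R$ is $C^2$, $f|_Z$ has a local maximum at $p\in Z$ and $Df(p)\neq0$, then $$F_{ij}\Big(p,\tfrac{Df(p)}{|Df(p)|}\Big)D_{ij}f(p)+(\partial_iF_i)\Big(p,\tfrac{Df(p)}{|Df(p)|}\Big)|Df(p)|\le h\,|Df(p)|.$$ *)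

theory Defs
  imports "HOL-Analysis.Analysis"
begin

text \<open>The ambient space \<open>\<real>\<^sup>m\<^sup>+\<^sup>1\<close> is \<open>real ^ 'n\<close>, so that \<open>m + 1 = CARD('n)\<close>, and the unit sphere
  is \<open>sphere 0 1\<close>. Functions given on an open set \<open>\<Omega>\<close> are total functions whose values off \<open>\<Omega>\<close> are
  irrelevant.\<close>

definition C1_on :: "'a::real_normed_vector set \<Rightarrow> ('a \<Rightarrow> 'b::real_normed_vector) \<Rightarrow> bool" where
  "C1_on S f \<longleftrightarrow> (\<exists>f' :: 'a \<Rightarrow> 'a \<Rightarrow>\<^sub>L 'b.
     (\<forall>x\<in>S. (f has_derivative blinfun_apply (f' x)) (at x)) \<and> continuous_on S f')"

definition C2_on :: "'a::real_normed_vector set \<Rightarrow> ('a \<Rightarrow> 'b::real_normed_vector) \<Rightarrow> bool" where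
  "C2_on S f \<longleftrightarrow> (\<exists>f' :: 'a \<Rightarrow> 'a \<Rightarrow>\<^sub>L 'b.
     (\<forall>x\<in>S. (f has_derivative blinfun_apply (f' x)) (at x)) \<and> C1_on S f')"

definition partial :: "'n::finite \<Rightarrow> (real ^ 'n \<Rightarrow> real) \<Rightarrow> real ^ 'n \<Rightarrow> real" where
  "partial i f x = frechet_derivative f (at x) (axis i 1)"

definition grad :: "(real ^ 'n::finite \<Rightarrow> real) \<Rightarrow> real ^ 'n \<Rightarrow> real ^ 'n" where
  "grad f x = (\<chi> i. partial i f x)"

text \<open>An integrand is only given for nonzero second argument; the clause \<open>F x 0 = 0\<close> fixes the usual
  extension, which the dual norm refers to and which makes the triangle inequality meaningful
  when \<open>v + w = 0\<close>.\<close>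

definition anisotropic_integrand ::
    "(real ^ 'n::finite) set \<Rightarrow> (real ^ 'n \<Rightarrow> real ^ 'n \<Rightarrow> real) \<Rightarrow> bool" where
  "anisotropic_integrand \<Omega> F \<longleftrightarrow>
     C2_on (\<Omega> \<times> (UNIV - {0})) (\<lambda>(x, v). F x v) \<and>
     (\<forall>x\<in>\<Omega>. \<forall>v. v \<noteq> 0 \<longrightarrow> F x v > 0) \<and>
     (\<forall>x\<in>\<Omega>. F x 0 = 0) \<and>
     (\<forall>x\<in>\<Omega>. \<forall>c v. c \<noteq> 0 \<longrightarrow> F x (c *\<^sub>R v) = \<bar>c\<bar> * F x v) \<and>
     (\<forall>x\<in>\<Omega>. \<forall>v w. F x (v + w) \<le> F x v + F x w)"

definition dual_norm ::
    "(real ^ 'n::finite \<Rightarrow> real ^ 'n \<Rightarrow> real) \<Rightarrow> real ^ 'n \<Rightarrow> real ^ 'n \<Rightarrow> real" where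
  "dual_norm F x w = (SUP v\<in>{v. F x v \<le> 1}. v \<bullet> w)"

definition radon_measure_on :: "'a::topological_space set \<Rightarrow> 'a measure \<Rightarrow> bool" where
  "radon_measure_on S M \<longleftrightarrow>
     space M = S \<and> sets M = sets (restrict_space borel S) \<and>
     (\<forall>K. compact K \<and> K \<subseteq> S \<longrightarrow> emeasure M K < \<infinity>) \<and>
     (\<forall>A\<in>sets M. emeasure M A = (SUP K\<in>{K. compact K \<and> K \<subseteq> A}. emeasure M K))"

definition varifold :: "(real ^ 'n::finite) set \<Rightarrow> ((real ^ 'n) \<times> (real ^ 'n)) measure \<Rightarrow> bool" where
  "varifold \<Omega> V \<longleftrightarrow>
     radon_measure_on (\<Omega> \<times> sphere 0 1) V \<and>
     (\<forall>A\<in>sets borel. \<forall>S\<in>sets borel. A \<subseteq> \<Omega> \<and> S \<subseteq> sphere 0 1 \<longrightarrow>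
        emeasure V (A \<times> S) = emeasure V (A \<times> uminus ` S))"

definition weight ::
    "(real ^ 'n::finite) set \<Rightarrow> ((real ^ 'n) \<times> (real ^ 'n)) measure \<Rightarrow> (real ^ 'n) measure" where
  "weight \<Omega> V = distr V (restrict_space borel \<Omega>) fst"

text \<open>Compactly supported fields on \<open>\<Omega>\<close> are represented by their extension by zero.\<close>

definition C1c :: "(real ^ 'n::finite) set \<Rightarrow> (real ^ 'n \<Rightarrow> real ^ 'n) \<Rightarrow> bool" where
  "C1c \<Omega> g \<longleftrightarrow>
     C1_on \<Omega> g \<and> compact (closure {x. g x \<noteq> 0}) \<and> closure {x. g x \<noteq> 0} \<subseteq> \<Omega>"

definition frobenius :: "real ^ 'n ^ 'n \<Rightarrow> real ^ 'n ^ 'n::finite \<Rightarrow> real" where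
  "frobenius A B = trace (transpose A ** B)"

definition B_tensor ::
    "(real ^ 'n::finite \<Rightarrow> real ^ 'n \<Rightarrow> real) \<Rightarrow> real ^ 'n \<Rightarrow> real ^ 'n \<Rightarrow> real ^ 'n ^ 'n" where
  "B_tensor F x v = F x v *\<^sub>R mat 1 - (\<chi> i j. v $ i * grad (F x) v $ j)"

definition first_variation ::
    "(real ^ 'n::finite \<Rightarrow> real ^ 'n \<Rightarrow> real) \<Rightarrow> ((real ^ 'n) \<times> (real ^ 'n)) measure \<Rightarrow>
     (real ^ 'n \<Rightarrow> real ^ 'n) \<Rightarrow> real" where
  "first_variation F V g =
     (\<integral>(x, v). grad (\<lambda>y. F y v) x \<bullet> g x
        + frobenius (B_tensor F x v) (jacobian g (at x)) \<partial>V)"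

definition mh_set ::
    "(real ^ 'n::finite) set \<Rightarrow> (real ^ 'n \<Rightarrow> real ^ 'n \<Rightarrow> real) \<Rightarrow> real \<Rightarrow>
     (real ^ 'n) set \<Rightarrow> bool" where
  "mh_set \<Omega> F h Z \<longleftrightarrow>
     closedin (top_of_set \<Omega>) Z \<and>
     (\<forall>f p. C2_on \<Omega> f \<and> p \<in> Z \<and> (\<exists>e>0. \<forall>y\<in>Z \<inter> ball p e. f y \<le> f p) \<and> grad f p \<noteq> 0 \<longrightarrow>
        (let u = grad f p /\<^sub>R norm (grad f p) in
          (\<Sum>i\<in>UNIV. \<Sum>j\<in>UNIV. partial i (partial j (F p)) u * partial i (partial j f) p)
          + (\<Sum>i\<in>UNIV. partial i (\<lambda>x. partial i (F x) u) p) * norm (grad f p)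
          \<le> h * norm (grad f p)))"

definition area_blowup_set ::
    "(real ^ 'n::finite) set \<Rightarrow> (nat \<Rightarrow> ((real ^ 'n) \<times> (real ^ 'n)) measure) \<Rightarrow> (real ^ 'n) set" where
  "area_blowup_set \<Omega> V =
     {x \<in> closure \<Omega>. \<forall>r>0. limsup (\<lambda>k. emeasure (weight \<Omega> (V k)) (ball x r \<inter> \<Omega>)) = \<infinity>}"

end

theory Submission
  imports Defs
begin

text \<open>
  The proof is a barrier argument. Suppose that \<open>f\<close> touches the blow-up set \<open>Z\<close> at
  \<open>p\<close> and violates the inequality. Normalising \<open>f\<close> so that \<open>f(p) = 0\<close> and
  \<open>\<bar>Df(p)\<bar> = 1\<close> and subtracting \<open>\<bar>x - p\<bar>\<^sup>4\<close>, which does not change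
  the 2-jet at \<open>p\<close>, gives a function \<open>g\<close> with \<open>g(p) = 0\<close> that is strictly
  negative on the rest of \<open>Z\<close> near \<open>p\<close>. Let \<open>W = Dg\<close> and \<open>Y(x) =
  D\<^sub>2F(x, W(x))\<close>. Convexity and homogeneity of \<open>F\<close> give \<open>Y\<close> the dual norm 1,
  and \<open>div Y(p)\<close> is exactly the left-hand side of the inequality, so \<open>div Y(p) > h\<close> (lemma
  \<open>divergence_grad_field\<close>).

  Test the first variation with \<open>X = \<eta> \<phi>(g) Y\<close>, where \<open>\<eta>\<close> is a cutoff around
  \<open>p\<close> and \<open>\<phi>\<close> vanishes below a level \<open>-\<epsilon>\<close>. The integrand of
  \<open>\<delta>\<^sub>FV(X) - h \<integral> \<parallel>X\<parallel>\<^sub>* F\<close> is \<open>\<eta> (\<phi> Q +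
  \<phi>' P)\<close> plus a term with \<open>D\<eta>\<close>. Here \<open>Q\<close> is the contribution of
  \<open>Y\<close> itself, and \<open>P = F(x,\<nu>) F(x,W) - \<langle>\<nu>,Y\<rangle>
  \<langle>D\<^sub>2F(x,\<nu>),W\<rangle>\<close> is nonnegative by convexity; it measures how far the hyperplane
  normal to \<open>\<nu>\<close> is tilted from the tangent plane of the level set of \<open>g\<close>. At
  \<open>p\<close>, every \<open>\<nu>\<close> with \<open>P = 0\<close> satisfies \<open>Q = F(p,\<nu>) (div Y(p) -
  h) > 0\<close> (lemma \<open>variation_density_untilted\<close>). When the unit ball of \<open>F(p,\<cdot>)\<close>
  has flat parts there are such \<open>\<nu>\<close> other than \<open>\<plusminus>W(p)\<close>; they are all covered
  because \<open>F(x,\<nu>) - \<bar>\<langle>\<nu>,Y(x)\<rangle>\<bar>\<close> is nonnegative and vanishes at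
  \<open>(p,\<nu>)\<close>, so that \<open>F(x,\<nu>)\<close> and
  \<open>\<plusminus>\<langle>\<nu>,Y(x)\<rangle>\<close> have the same derivatives there in both variables. By
  compactness of the sphere \<open>Q + C P\<close> is bounded below by a positive constant near \<open>p\<close> for
  some \<open>C\<close> (lemma \<open>calibration\<close>), and \<open>\<phi>\<close> is chosen with \<open>\<phi>'
  \<ge> C \<phi>\<close>.

  The term with \<open>D\<eta>\<close> lives on a compact set where \<open>g \<ge> -\<epsilon>\<close> and
  \<open>x\<close> is away from \<open>p\<close>, hence off \<open>Z\<close> (lemma
  \<open>cutoff_calibration\<close>). There the masses \<open>\<parallel>V\<^sub>k\<parallel>\<close> are bounded for
  large \<open>k\<close>, while on a small ball around \<open>p\<close> they are unbounded; so the tested quantity is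
  unbounded in \<open>k\<close>, against the hypothesis (lemma \<open>area_blowup_touching\<close>).
\<close>

section \<open>Continuously differentiable maps\<close>

text \<open>In finite dimension the operator-norm continuity of the derivative can be tested on vectors, so each
  closure property below reduces to the continuity of an explicit formula.\<close>
lemma C1_onI:
  fixes f :: "'a::euclidean_space \<Rightarrow> 'b::real_normed_vector"
  assumes f: "\<And>x. x \<in> S \<Longrightarrow> (f has_derivative f' x) (at x)"
    and f': "\<And>h. continuous_on S (\<lambda>x. f' x h)"
  shows "C1_on S f"
  unfolding C1_on_def
proof (intro exI conjI ballI)
  let ?L = "\<lambda>x. Blinfun (f' x)"
  have L: "blinfun_apply (?L x) = f' x" if "x \<in> S" for x
    using f[OF that] by (simp add: bounded_linear_Blinfun_apply has_derivative_bounded_linear)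
  show "(f has_derivative blinfun_apply (?L x)) (at x)" if "x \<in> S" for x
    using f[OF that] L[OF that] by simp
  show "continuous_on S ?L"
  proof (rule continuous_on_blinfun_componentwise)
    show "continuous_on S (\<lambda>x. blinfun_apply (?L x) i)" for i
      using f'[of i] by (rule continuous_on_eq) (simp add: L)
  qed
qed

lemma C1_onE:
  assumes "C1_on S f"
  obtains f' where "\<And>x. x \<in> S \<Longrightarrow> (f has_derivative blinfun_apply (f' x)) (at x)"
    and "continuous_on S f'"
  using assms unfolding C1_on_def by blast

lemma C1_on_subset: "C1_on S f \<Longrightarrow> T \<subseteq> S \<Longrightarrow> C1_on T f"
  unfolding C1_on_def by (meson continuous_on_subset subsetD)

lemma C1_on_continuous: "C1_on S f \<Longrightarrow> continuous_on S f"
  by (metis C1_onE continuous_at_imp_continuous_on has_derivative_continuous)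

lemma C1_on_cong_open:
  assumes "open S" "C1_on S f" "\<And>x. x \<in> S \<Longrightarrow> f x = g x"
  shows "C1_on S g"
  using assms unfolding C1_on_def
  by (meson has_derivative_transform_within_open)

lemma C1_on_compose:
  fixes g :: "'a::euclidean_space \<Rightarrow> 'b::real_normed_vector"
  assumes "C1_on T f" "C1_on S g" "\<And>x. x \<in> S \<Longrightarrow> g x \<in> T"
  shows "C1_on S (\<lambda>x. f (g x))"
proof -
  obtain f' where f': "\<And>x. x \<in> T \<Longrightarrow> (f has_derivative blinfun_apply (f' x)) (at x)"
      "continuous_on T f'" using C1_onE[OF assms(1)] by blast
  obtain g' where g': "\<And>x. x \<in> S \<Longrightarrow> (g has_derivative blinfun_apply (g' x)) (at x)"
      "continuous_on S g'" using C1_onE[OF assms(2)] by blast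
  have "continuous_on S (\<lambda>x. f' (g x))"
    by (rule continuous_on_compose2[OF f'(2) C1_on_continuous[OF assms(2)]]) (use assms(3) in auto)
  then have "continuous_on S (\<lambda>x. f' (g x) (g' x h))" for h
    by (intro continuous_intros g'(2))
  moreover have "((\<lambda>x. f (g x)) has_derivative (\<lambda>h. f' (g x) (g' x h))) (at x)" if "x \<in> S" for x
    using has_derivative_compose[OF g'(1)[OF that] f'(1)[OF assms(3)[OF that]]] .
  ultimately show ?thesis by (rule C1_onI[rotated])
qed

lemma C1_on_Pair:
  fixes f :: "'a::euclidean_space \<Rightarrow> 'b::real_normed_vector"
    and g :: "'a \<Rightarrow> 'c::real_normed_vector"
  assumes "C1_on S f" "C1_on S g"
  shows "C1_on S (\<lambda>x. (f x, g x))"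
  using assms by (elim C1_onE) (rule C1_onI, rule has_derivative_Pair, auto intro!: continuous_intros)

lemma C1_on_bounded_linear:
  fixes f :: "'a::euclidean_space \<Rightarrow> 'b::real_normed_vector"
  assumes "bounded_linear B" "C1_on S f"
  shows "C1_on S (\<lambda>x. B (f x))"
  using assms(2)
  by (elim C1_onE) (rule C1_onI, rule bounded_linear.has_derivative[OF assms(1)],
      auto intro!: continuous_intros bounded_linear.continuous_on[OF assms(1)])

lemma C1_on_scaleR:
  fixes f :: "'a::euclidean_space \<Rightarrow> 'b::real_normed_vector"
  assumes "C1_on S s" "C1_on S f"
  shows "C1_on S (\<lambda>x. s x *\<^sub>R f x)"
  using C1_on_continuous[OF assms(1)] C1_on_continuous[OF assms(2)] assms
  by (elim C1_onE) (rule C1_onI, rule has_derivative_scaleR, auto intro!: continuous_intros)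

lemma C1_on_diff:
  fixes f :: "'a::euclidean_space \<Rightarrow> 'b::real_normed_vector"
  assumes "C1_on S f" "C1_on S g"
  shows "C1_on S (\<lambda>x. f x - g x)"
  using assms
  by (elim C1_onE) (rule C1_onI, rule has_derivative_diff, auto intro!: continuous_intros)

lemma C1_on_const:
  fixes c :: "'b::real_normed_vector"
  shows "C1_on (S :: 'a::euclidean_space set) (\<lambda>_. c)"
  by (rule C1_onI) (rule has_derivative_const, auto)

lemma C1_on_ident: "C1_on (S :: 'a::euclidean_space set) (\<lambda>x. x)"
  by (rule C1_onI) (rule has_derivative_ident, auto)

text \<open>The Riesz representation in coordinates, which links Frechet derivatives to gradients.\<close>
lemma linear_real_eq_inner:
  fixes L :: "real ^ 'n::finite \<Rightarrow> real"
  assumes "linear L"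
  shows "L h = (\<chi> i. L (axis i 1)) \<bullet> h"
proof -
  have "L h = L (\<Sum>i\<in>UNIV. h $ i *\<^sub>R axis i 1)"
    using basis_expansion[of h] by (simp add: scalar_mult_eq_scaleR)
  also have "\<dots> = (\<Sum>i\<in>UNIV. h $ i * L (axis i 1))"
    by (simp add: linear_sum[OF assms] linear_cmul[OF assms])
  finally show ?thesis by (simp add: inner_vec_def mult.commute)
qed

lemma has_derivative_grad:
  fixes f :: "real ^ 'n::finite \<Rightarrow> real"
  assumes "f differentiable (at x)"
  shows "(f has_derivative (\<lambda>h. grad f x \<bullet> h)) (at x)"
proof -
  have "(f has_derivative frechet_derivative f (at x)) (at x)"
    using assms by (simp add: frechet_derivative_works)
  moreover from this have "frechet_derivative f (at x) = (\<lambda>h. grad f x \<bullet> h)"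
    unfolding grad_def partial_def
    by (intro ext linear_real_eq_inner has_derivative_linear)
  ultimately show ?thesis by simp
qed

lemma bounded_linear_functional_to_vec:
  "bounded_linear (\<lambda>L :: 'a::real_normed_vector \<Rightarrow>\<^sub>L real. (\<chi> i. blinfun_apply L (b i)) :: real ^ 'n::finite)"
  by (subst bounded_linear_componentwise_iff)
    (auto simp: Basis_vec_def inner_axis blinfun.bounded_linear_left)

lemma C2_on_grad:
  fixes f :: "real ^ 'n::finite \<Rightarrow> real"
  assumes "open S" "C2_on S f"
  shows "C1_on S (grad f)" and "\<And>x. x \<in> S \<Longrightarrow> f differentiable (at x)"
proof -
  obtain f' :: "real ^ 'n \<Rightarrow> (real ^ 'n) \<Rightarrow>\<^sub>L real"
    where f': "\<And>x. x \<in> S \<Longrightarrow> (f has_derivative blinfun_apply (f' x)) (at x)" "C1_on S f'"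
    using assms(2) unfolding C2_on_def by blast
  show "f differentiable (at x)" if "x \<in> S" for x
    using f'(1)[OF that] by (rule differentiableI)
  have "(\<chi> i. f' x (axis i 1)) = grad f x" if "x \<in> S" for x
    using frechet_derivative_at[OF f'(1)[OF that], symmetric] by (simp add: grad_def partial_def)
  then show "C1_on S (grad f)"
    by (rule C1_on_cong_open[OF assms(1) C1_on_bounded_linear[OF bounded_linear_functional_to_vec f'(2)]])
qed

text \<open>The form in which a field cut off near a point becomes an admissible field on the whole space: the
  two open sets \<open>U\<close> and \<open>- K\<close> cover everything, and the formulas agree on the overlap.\<close>
lemma C1_on_extend_zero:
  fixes g :: "'a::euclidean_space \<Rightarrow> 'b::real_normed_vector"
  assumes U: "open U" and K: "closed K" "K \<subseteq> U" and g: "C1_on U g" "\<And>x. x \<in> U - K \<Longrightarrow> g x = 0"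
  shows "C1_on UNIV (\<lambda>x. if x \<in> U then g x else 0)"
proof -
  let ?g = "\<lambda>x. if x \<in> U then g x else 0"
  obtain g' where g': "\<And>x. x \<in> U \<Longrightarrow> (g has_derivative blinfun_apply (g' x)) (at x)" "continuous_on U g'"
    using C1_onE[OF g(1)] by blast
  let ?g' = "\<lambda>x. if x \<in> U then g' x else 0"
  have zero: "g' x = 0" if "x \<in> U - K" for x
  proof -
    have "(g has_derivative (\<lambda>_. 0)) (at x)"
      by (rule has_derivative_transform_within_open[of "\<lambda>_. 0" _ _ _ "U - K"])
        (use that g(2) U K in \<open>auto intro: open_Diff\<close>)
    then have "blinfun_apply (g' x) = (\<lambda>_. 0)" using g'(1) that by (blast intro: has_derivative_unique)
    then show ?thesis by (simp add: blinfun_eqI)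
  qed
  have opK: "open (- K)" using K(1) by (rule open_Compl)
  have un: "UNIV = U \<union> - K" using K by blast
  show ?thesis
    unfolding C1_on_def
  proof (intro exI conjI ballI)
    show "(?g has_derivative blinfun_apply (?g' x)) (at x)" for x
    proof (cases "x \<in> U")
      case True
      then show ?thesis
        using has_derivative_transform_within_open[OF g'(1)[OF True] U True, of ?g] by simp
    next
      case False
      then have "x \<in> - K" using K by blast
      moreover have "0 = ?g y" if "y \<in> - K" for y using g(2)[of y] that by auto
      ultimately have "(?g has_derivative (\<lambda>_. 0)) (at x)"
        by (rule has_derivative_transform_within_open[OF has_derivative_const[of 0] opK])
      then show ?thesis using False by (simp add: zero_blinfun.rep_eq)
    qed
    have "continuous_on U ?g'" using g'(2) by (rule continuous_on_eq) simp
    moreover have "continuous_on (- K) ?g'"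
      using continuous_on_const[of "- K" 0] by (rule continuous_on_eq) (use zero in auto)
    ultimately show "continuous_on UNIV ?g'"
      unfolding un using U K by (intro continuous_on_open_Un) auto
  qed
qed

section \<open>Symmetry of second derivatives\<close>

text \<open>The second difference over a parallelogram with sides \<open>t a\<close> and \<open>t b\<close>, by the mean value theorem
  first in the direction \<open>a\<close> and then in the direction \<open>b\<close>. Its left-hand side is symmetric in \<open>a\<close> and
  \<open>b\<close>, which gives the symmetry of second derivatives as \<open>t\<close> tends to 0.\<close>
lemma second_difference_mean_value:
  fixes f :: "real ^ 'n::finite \<Rightarrow> real"
  assumes f: "\<And>x. x \<in> ball p r \<Longrightarrow> (f has_derivative (\<lambda>h. g x \<bullet> h)) (at x)"
    and g: "\<And>x. x \<in> ball p r \<Longrightarrow> (g has_derivative blinfun_apply (g' x)) (at x)"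
    and t: "t > 0" "t * (norm a + norm b) < r"
  obtains q where "dist p q \<le> t * (norm a + norm b)"
    and "f (p + t *\<^sub>R a + t *\<^sub>R b) - f (p + t *\<^sub>R a) - f (p + t *\<^sub>R b) + f p
          = t * t * (g' q b \<bullet> a)"
proof -
  have near: "dist p (p + s *\<^sub>R a + u *\<^sub>R b) \<le> t * (norm a + norm b)"
    if "0 \<le> s" "s \<le> t" "0 \<le> u" "u \<le> t" for s u
  proof -
    have "norm (s *\<^sub>R a + u *\<^sub>R b) \<le> s * norm a + u * norm b"
      using norm_triangle_ineq[of "s *\<^sub>R a" "u *\<^sub>R b"] that by simp
    also have "\<dots> \<le> t * norm a + t * norm b"
      using that by (intro add_mono mult_right_mono) auto
    finally show ?thesis
      by (metis add.assoc add_diff_cancel_left' dist_commute dist_norm distrib_left)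
  qed
  have inb: "p + s *\<^sub>R a + u *\<^sub>R b \<in> ball p r" if "0 \<le> s" "s \<le> t" "0 \<le> u" "u \<le> t" for s u
    using near[OF that] t(2) by simp
  define k where "k s = f (p + s *\<^sub>R a + t *\<^sub>R b) - f (p + s *\<^sub>R a)" for s
  have k: "(k has_derivative (\<lambda>d. d * ((g (p + s *\<^sub>R a + t *\<^sub>R b) - g (p + s *\<^sub>R a)) \<bullet> a))) (at s)"
    if "0 \<le> s" "s \<le> t" for s
  proof -
    have 1: "((\<lambda>s. f (p + s *\<^sub>R a + u *\<^sub>R b)) has_derivative (\<lambda>d. g (p + s *\<^sub>R a + u *\<^sub>R b) \<bullet> (d *\<^sub>R a))) (at s)"
      if u: "0 \<le> u" "u \<le> t" for u
      by (rule has_derivative_compose[where f = "\<lambda>s. p + s *\<^sub>R a + u *\<^sub>R b",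
            OF _ f[OF inb[OF \<open>0 \<le> s\<close> \<open>s \<le> t\<close> u]]])
        (auto intro!: derivative_eq_intros)
    show ?thesis
      unfolding k_def using has_derivative_diff[OF 1[of t] 1[of 0]] t(1)
      by (simp add: inner_diff_left algebra_simps)
  qed
  obtain s where s: "0 < s" "s < t"
    and ks: "k t - k 0 = t * ((g (p + s *\<^sub>R a + t *\<^sub>R b) - g (p + s *\<^sub>R a)) \<bullet> a)"
  proof -
    have "\<exists>s\<in>{0<..<t}. k t - k 0 = (t - 0) * ((g (p + s *\<^sub>R a + t *\<^sub>R b) - g (p + s *\<^sub>R a)) \<bullet> a)"
      by (rule mvt_simple[OF t(1)]) (use k in \<open>auto intro: has_derivative_at_withinI\<close>)
    with that show thesis by auto
  qed
  have l: "((\<lambda>u. g (p + s *\<^sub>R a + u *\<^sub>R b) \<bullet> a) has_derivative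
      (\<lambda>d. d * (g' (p + s *\<^sub>R a + u *\<^sub>R b) b \<bullet> a))) (at u)" if u: "0 \<le> u" "u \<le> t" for u
  proof -
    have "((\<lambda>u. g (p + s *\<^sub>R a + u *\<^sub>R b)) has_derivative (\<lambda>d. g' (p + s *\<^sub>R a + u *\<^sub>R b) (d *\<^sub>R b))) (at u)"
      by (rule has_derivative_compose[where f = "\<lambda>u. p + s *\<^sub>R a + u *\<^sub>R b", OF _ g[OF inb[of s u]]])
        (use s u in \<open>auto intro!: derivative_eq_intros\<close>)
    from has_derivative_inner_left[OF this, of a] show ?thesis
      by (simp add: blinfun.scaleR_right)
  qed
  obtain u where u: "0 < u" "u < t"
    and lu: "g (p + s *\<^sub>R a + t *\<^sub>R b) \<bullet> a - g (p + s *\<^sub>R a) \<bullet> a = t * (g' (p + s *\<^sub>R a + u *\<^sub>R b) b \<bullet> a)"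
  proof -
    have "\<exists>u\<in>{0<..<t}. g (p + s *\<^sub>R a + t *\<^sub>R b) \<bullet> a - g (p + s *\<^sub>R a + 0 *\<^sub>R b) \<bullet> a
        = (t - 0) * (g' (p + s *\<^sub>R a + u *\<^sub>R b) b \<bullet> a)"
      by (rule mvt_simple[OF t(1)]) (use l in \<open>auto intro: has_derivative_at_withinI\<close>)
    with that show thesis by auto
  qed
  show thesis
  proof
    show "dist p (p + s *\<^sub>R a + u *\<^sub>R b) \<le> t * (norm a + norm b)"
      using near s u by simp
    show "f (p + t *\<^sub>R a + t *\<^sub>R b) - f (p + t *\<^sub>R a) - f (p + t *\<^sub>R b) + f p
          = t * t * (g' (p + s *\<^sub>R a + u *\<^sub>R b) b \<bullet> a)"
      using ks lu by (simp add: k_def inner_diff_left)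
  qed
qed

lemma second_derivative_symmetric:
  fixes f :: "real ^ 'n::finite \<Rightarrow> real"
  assumes "open S" "p \<in> S"
    and f: "\<And>x. x \<in> S \<Longrightarrow> (f has_derivative (\<lambda>h. g x \<bullet> h)) (at x)"
    and g: "\<And>x. x \<in> S \<Longrightarrow> (g has_derivative blinfun_apply (g' x)) (at x)"
    and g': "continuous_on S g'"
  shows "g' p b \<bullet> a = g' p a \<bullet> b"
proof -
  obtain r where r: "r > 0" "ball p r \<subseteq> S"
    using assms(1,2) openE by blast
  \<comment> \<open>The summand 1 keeps the quotient meaningful when \<open>a\<close> and \<open>b\<close> both vanish.\<close>
  define N where "N = norm a + norm b + 1"
  have N: "N > 0" "norm a + norm b \<le> N" by (simp_all add: N_def add_nonneg_pos)
  define t where "t n = r / (2 * N) / real (Suc n)" for n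
  have tpos: "t n > 0" for n using r N by (simp add: t_def)
  have tlim: "t \<longlonglongrightarrow> 0"
    unfolding t_def using LIMSEQ_Suc[OF lim_const_over_n[of "r / (2 * N)"]] by simp
  have small: "t n * (norm a + norm b) < r" for n
  proof -
    have "t n * (norm a + norm b) \<le> t n * N"
      using N tpos[of n] by simp
    also have "\<dots> = r / 2 / real (Suc n)" using N by (simp add: t_def)
    also have "\<dots> \<le> r / 2 / 1" using r by (intro divide_left_mono) auto
    finally show ?thesis using r by simp
  qed
  have fb: "\<And>x. x \<in> ball p r \<Longrightarrow> (f has_derivative (\<lambda>h. g x \<bullet> h)) (at x)"
    and gb: "\<And>x. x \<in> ball p r \<Longrightarrow> (g has_derivative blinfun_apply (g' x)) (at x)"
    using r f g by blast+
  have "\<exists>q q'. dist p q \<le> t n * (norm a + norm b) \<and> dist p q' \<le> t n * (norm a + norm b)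
      \<and> g' q b \<bullet> a = g' q' a \<bullet> b" for n
  proof -
    obtain q where q: "dist p q \<le> t n * (norm a + norm b)"
      "f (p + t n *\<^sub>R a + t n *\<^sub>R b) - f (p + t n *\<^sub>R a) - f (p + t n *\<^sub>R b) + f p
          = t n * t n * (g' q b \<bullet> a)"
      using second_difference_mean_value[OF fb gb tpos small] .
    obtain q' where q': "dist p q' \<le> t n * (norm b + norm a)"
      "f (p + t n *\<^sub>R b + t n *\<^sub>R a) - f (p + t n *\<^sub>R b) - f (p + t n *\<^sub>R a) + f p
          = t n * t n * (g' q' a \<bullet> b)"
      using second_difference_mean_value[OF fb gb tpos, where a = b and b = a] small[of n]
      by (metis add.commute)
    have "p + t n *\<^sub>R b + t n *\<^sub>R a = p + t n *\<^sub>R a + t n *\<^sub>R b" by simp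
    then have "f (p + t n *\<^sub>R b + t n *\<^sub>R a) = f (p + t n *\<^sub>R a + t n *\<^sub>R b)" by (simp only:)
    then have "t n * t n * (g' q b \<bullet> a) = t n * t n * (g' q' a \<bullet> b)"
      using q(2) q'(2) by linarith
    then show ?thesis using q(1) q'(1) tpos[of n] by (auto simp: add.commute)
  qed
  then obtain q q' where qq: "\<And>n. dist p (q n) \<le> t n * (norm a + norm b)"
      "\<And>n. dist p (q' n) \<le> t n * (norm a + norm b)"
      "\<And>n. g' (q n) b \<bullet> a = g' (q' n) a \<bullet> b" by metis
  have lim: "x \<longlonglongrightarrow> p" if "\<And>n. dist p (x n) \<le> t n * (norm a + norm b)" for x
  proof -
    have "(\<lambda>n. dist (x n) p) \<longlonglongrightarrow> 0"
      by (rule tendsto_sandwich[OF _ _ tendsto_const tendsto_mult_left_zero[OF tlim, of "norm a + norm b"]])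
        (use that in \<open>auto simp: dist_commute\<close>)
    then show ?thesis by (subst tendsto_dist_iff)
  qed
  have "isCont g' p" using g' assms(1,2) by (simp add: continuous_on_eq_continuous_at)
  then have "isCont (\<lambda>x. g' x c \<bullet> d) p" for c d
    by (intro continuous_intros) (simp_all add: continuous_at_imp_continuous_at_within)
  then have c: "(\<lambda>n. g' (x n) c \<bullet> d) \<longlonglongrightarrow> g' p c \<bullet> d" if "x \<longlonglongrightarrow> p" for x c d
    using isCont_tendsto_compose[OF _ that, of "\<lambda>x. g' x c \<bullet> d"] by simp
  have "(\<lambda>n. g' (q n) b \<bullet> a) \<longlonglongrightarrow> g' p a \<bullet> b"
    unfolding qq(3) by (rule c[OF lim[OF qq(2)]])
  then show ?thesis
    by (rule LIMSEQ_unique[OF c[OF lim[OF qq(1)]]])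
qed

section \<open>Cutoff functions and a compactness principle\<close>

text \<open>The squared positive part serves both as the building block of cutoffs and as the profile \<open>\<phi>\<close> of the
  test field: it is \<open>C\<^sup>1\<close>, and near its zero set its logarithmic derivative is as large as desired.\<close>
definition sqpos :: "real \<Rightarrow> real" where "sqpos t = (max 0 t)\<^sup>2"

lemma sqpos_nonneg: "sqpos t \<ge> 0" and sqpos_eq_0: "t \<le> 0 \<Longrightarrow> sqpos t = 0"
  by (auto simp: sqpos_def)

lemma has_derivative_sqpos: "(sqpos has_derivative (\<lambda>h. 2 * max 0 t * h)) (at t)"
proof -
  consider "t > 0" | "t < 0" | "t = 0" by linarith
  then show ?thesis
  proof cases
    case 1
    show ?thesis
      by (rule has_derivative_transform_within_open[of "\<lambda>t. t\<^sup>2" _ _ _ "{0<..}"])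
        (use 1 in \<open>auto simp: sqpos_def intro!: derivative_eq_intros\<close>)
  next
    case 2
    show ?thesis
      by (rule has_derivative_transform_within_open[of "\<lambda>t. 0" _ _ _ "{..<0}"])
        (use 2 in \<open>auto simp: sqpos_def intro!: derivative_eq_intros\<close>)
  next
    case 3
    have "((\<lambda>h. sqpos h / h) \<longlongrightarrow> 0) (at 0)"
    proof (rule Lim_null_comparison)
      show "\<forall>\<^sub>F h in at 0. norm (sqpos h / h) \<le> \<bar>h\<bar>"
        by (rule always_eventually) (auto simp: sqpos_def max_def power2_eq_square)
      show "((\<lambda>h::real. \<bar>h\<bar>) \<longlongrightarrow> 0) (at 0)" by (auto intro!: tendsto_eq_intros)
    qed
    then have "(sqpos has_real_derivative 0) (at 0)" by (simp add: DERIV_def sqpos_def)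
    then show ?thesis using 3 by (simp add: has_field_derivative_def lambda_zero)
  qed
qed

lemma C1_on_sqpos: "C1_on S sqpos"
  by (rule C1_onI[OF has_derivative_sqpos]) (intro continuous_intros)

lemma C1_cutoff:
  fixes p :: "'a::euclidean_space"
  assumes "0 < a" "a < b"
  obtains \<eta> :: "'a \<Rightarrow> real" where "C1_on UNIV \<eta>" "\<And>x. \<eta> x \<ge> 0"
    "\<And>x. dist p x \<le> a \<Longrightarrow> \<eta> x = 1" "\<And>x. dist p x \<ge> b \<Longrightarrow> \<eta> x = 0"
proof -
  let ?k = "b\<^sup>2 - a\<^sup>2"
  have k: "?k > 0" using assms by (simp add: power_strict_mono)
  define \<eta> where "\<eta> x = sqpos (1 - (1 / ?k\<^sup>2) *\<^sub>R sqpos ((x - p) \<bullet> (x - p) - a\<^sup>2))" for x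
  have d: "(x - p) \<bullet> (x - p) = (dist p x)\<^sup>2" for x
    by (metis dist_commute dist_norm power2_norm_eq_inner)
  show thesis
  proof
    have "C1_on UNIV (\<lambda>x. (x - p) \<bullet> (x - p) - a\<^sup>2)"
    proof (rule C1_onI)
      show "((\<lambda>x. (x - p) \<bullet> (x - p) - a\<^sup>2) has_derivative (\<lambda>h. 2 * ((x - p) \<bullet> h))) (at x)" for x
        by (auto intro!: derivative_eq_intros simp: inner_commute)
    qed (intro continuous_intros)
    then have sq: "C1_on UNIV (\<lambda>x. sqpos ((x - p) \<bullet> (x - p) - a\<^sup>2))"
      by (rule C1_on_compose[OF C1_on_sqpos[of UNIV]]) simp
    show "C1_on UNIV \<eta>"
      unfolding \<eta>_def
      by (rule C1_on_compose[OF C1_on_sqpos[of UNIV]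
            C1_on_diff[OF C1_on_const C1_on_scaleR[OF C1_on_const sq]]]) simp
    show "\<eta> x \<ge> 0" for x by (simp add: \<eta>_def sqpos_nonneg)
    show "\<eta> x = 1" if "dist p x \<le> a" for x
    proof -
      have "(dist p x)\<^sup>2 \<le> a\<^sup>2" using that by (simp add: power_mono)
      then show ?thesis by (simp add: \<eta>_def d sqpos_eq_0) (simp add: sqpos_def)
    qed
    show "\<eta> x = 0" if "dist p x \<ge> b" for x
    proof -
      have "b\<^sup>2 \<le> (dist p x)\<^sup>2" using that assms by (simp add: power_mono)
      then have "?k\<^sup>2 \<le> sqpos ((dist p x)\<^sup>2 - a\<^sup>2)"
        using k by (simp add: sqpos_def power_mono)
      then show ?thesis using k by (simp add: \<eta>_def d sqpos_eq_0)
    qed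
  qed
qed

text \<open>On the compact set where \<open>Q \<le> 0\<close> the penalty \<open>P\<close> is bounded away from zero, so a large multiple of it
  outweighs the lower bound of \<open>Q\<close>; elsewhere \<open>Q\<close> is already positive.\<close>
lemma compact_penalty:
  fixes P Q :: "'a::t2_space \<Rightarrow> real"
  assumes S: "compact S" and P: "continuous_on S P" and Q: "continuous_on S Q"
    and nonneg: "\<And>v. v \<in> S \<Longrightarrow> P v \<ge> 0"
    and pos: "\<And>v. v \<in> S \<Longrightarrow> P v = 0 \<Longrightarrow> Q v > 0"
  obtains C c where "C > 0" "c > 0" "\<And>v. v \<in> S \<Longrightarrow> c \<le> Q v + C * P v"
proof -
  have lower: "\<exists>m. m > 0 \<and> (\<forall>v\<in>A. m \<le> g v)"
    if A: "compact A" "continuous_on A g" "\<And>v. v \<in> A \<Longrightarrow> g v > 0" for A :: "'a set" and g :: "'a \<Rightarrow> real"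
  proof (cases "A = {}")
    case False
    from continuous_attains_inf[OF A(1) this A(2)] show ?thesis using A(3) by blast
  qed (auto intro: exI[of _ 1])
  define N where "N = {v \<in> S. Q v \<le> 0}"
  have "closed N"
    using continuous_closed_preimage[OF Q compact_imp_closed[OF S], of "{..0}"]
    by (simp add: N_def vimage_def Int_def)
  then have "compact N"
    using compact_Int_closed[OF S, of N] by (simp add: N_def Int_absorb1)
  moreover have "continuous_on N P" using P by (rule continuous_on_subset) (auto simp: N_def)
  moreover have "P v > 0" if "v \<in> N" for v
    using that nonneg[of v] pos[of v] by (force simp: N_def)
  ultimately obtain m where m: "m > 0" "\<forall>v\<in>N. m \<le> P v" using lower by blast
  have "bounded (Q ` S)" using S Q by (simp add: compact_continuous_image compact_imp_bounded)
  then obtain M where M: "\<And>v. v \<in> S \<Longrightarrow> \<bar>Q v\<bar> \<le> M" "M > 0"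
    unfolding bounded_pos by auto
  define C where "C = (M + 1) / m"
  have C: "C > 0" using m M by (simp add: C_def)
  have "Q v + C * P v > 0" if v: "v \<in> S" for v
  proof (cases "v \<in> N")
    case True
    then have "C * m \<le> C * P v" using m C by (intro mult_left_mono) auto
    moreover have "C * m = M + 1" using m by (simp add: C_def)
    ultimately have "M + 1 \<le> C * P v" by simp
    then show ?thesis using M(1)[OF v] by linarith
  next
    case False
    then have "Q v > 0" using v by (auto simp: N_def)
    then show ?thesis using C nonneg[OF v] by (simp add: add_pos_nonneg)
  qed
  moreover have "continuous_on S (\<lambda>v. Q v + C * P v)" by (intro continuous_intros P Q)
  ultimately obtain c where "c > 0" "\<forall>v\<in>S. c \<le> Q v + C * P v" using lower[OF S] by blast
  with C that show thesis by blast
qed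

section \<open>Convexity and homogeneity of the integrand\<close>

text \<open>Contracting with \<open>B_tensor\<close> is a trace term minus the bilinear expression of the linear map in the
  directions \<open>v\<close> and \<open>grad (F x) v\<close>, which is the form in which convexity of \<open>F x\<close> can be used.\<close>
lemma frobenius_B_tensor:
  assumes "linear L"
  shows "frobenius (B_tensor F x v) (matrix L)
    = F x v * (\<Sum>i\<in>UNIV. L (axis i 1) $ i) - v \<bullet> L (grad (F x) v)"
proof -
  let ?g = "grad (F x) v"
  have "L ?g = L (\<Sum>i\<in>UNIV. ?g $ i *\<^sub>R axis i 1)"
    using basis_expansion[of ?g] by (simp add: scalar_mult_eq_scaleR)
  also have "\<dots> = (\<Sum>i\<in>UNIV. ?g $ i *\<^sub>R L (axis i 1))"
    by (simp add: linear_sum[OF assms] linear_cmul[OF assms])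
  finally have "v \<bullet> L ?g = (\<Sum>i\<in>UNIV. \<Sum>k\<in>UNIV. v $ k * ?g $ i * L (axis i 1) $ k)"
    by (simp only: inner_sum_right inner_scaleR_right) (simp add: inner_vec_def sum_distrib_left mult_ac)
  moreover have "frobenius (B_tensor F x v) (matrix L)
      = (\<Sum>i\<in>UNIV. \<Sum>k\<in>UNIV. (F x v * (if k = i then 1 else 0) - v $ k * ?g $ i) * L (axis i 1) $ k)"
    by (simp add: frobenius_def trace_def matrix_matrix_mult_def transpose_def B_tensor_def mat_def matrix_def)
  moreover have "\<dots> = (\<Sum>i\<in>UNIV. (\<Sum>k\<in>UNIV. (if k = i then F x v * L (axis i 1) $ k else 0))
      - (\<Sum>k\<in>UNIV. v $ k * ?g $ i * L (axis i 1) $ k))"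
    unfolding sum_subtractf[symmetric] by (intro sum.cong refl) (simp add: algebra_simps)
  ultimately show ?thesis by (simp add: sum_subtractf sum_distrib_left)
qed

locale elliptic_integrand =
  fixes \<Omega> :: "(real ^ 'n::finite) set" and F :: "real ^ 'n \<Rightarrow> real ^ 'n \<Rightarrow> real"
  assumes open_domain: "open \<Omega>"
    and integrand: "anisotropic_integrand \<Omega> F"
begin

lemma F_pos: "x \<in> \<Omega> \<Longrightarrow> v \<noteq> 0 \<Longrightarrow> F x v > 0"
  and F_scale: "x \<in> \<Omega> \<Longrightarrow> c \<noteq> 0 \<Longrightarrow> F x (c *\<^sub>R v) = \<bar>c\<bar> * F x v"
  and F_triangle: "x \<in> \<Omega> \<Longrightarrow> F x (v + w) \<le> F x v + F x w"
  using integrand unfolding anisotropic_integrand_def by blast+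

lemma F_minus: "x \<in> \<Omega> \<Longrightarrow> F x (- v) = F x v"
  using F_scale[of x "-1" v] by simp

lemma integrand_derivatives:
  shows has_derivative_direction:
      "x \<in> \<Omega> \<Longrightarrow> v \<noteq> 0 \<Longrightarrow> (F x has_derivative (\<lambda>h. grad (F x) v \<bullet> h)) (at v)"
    and has_derivative_position:
      "x \<in> \<Omega> \<Longrightarrow> v \<noteq> 0 \<Longrightarrow> ((\<lambda>y. F y v) has_derivative (\<lambda>h. grad (\<lambda>y. F y v) x \<bullet> h)) (at x)"
    and C1_grad_direction: "C1_on (\<Omega> \<times> (UNIV - {0})) (\<lambda>(x, v). grad (F x) v)"
    and C1_grad_position: "C1_on (\<Omega> \<times> (UNIV - {0})) (\<lambda>(x, v). grad (\<lambda>y. F y v) x)"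
    and C1_F: "C1_on (\<Omega> \<times> (UNIV - {0})) (\<lambda>(x, v). F x v)"
proof -
  let ?S = "\<Omega> \<times> (UNIV - {0 :: real ^ 'n})"
  have S: "open ?S" using open_domain by (intro open_Times) auto
  have "C2_on ?S (\<lambda>(x, v). F x v)"
    using integrand unfolding anisotropic_integrand_def by (elim conjE)
  then obtain F' :: "(real ^ 'n) \<times> (real ^ 'n) \<Rightarrow> ((real ^ 'n) \<times> (real ^ 'n)) \<Rightarrow>\<^sub>L real"
    where F': "\<And>z. z \<in> ?S \<Longrightarrow> ((\<lambda>(x, v). F x v) has_derivative blinfun_apply (F' z)) (at z)"
      and C1: "C1_on ?S F'"
    unfolding C2_on_def by blast
  show "C1_on ?S (\<lambda>(x, v). F x v)"
    unfolding C1_on_def using F' C1_on_continuous[OF C1] by blast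
  have dir: "(F x has_derivative (\<lambda>h. F' (x, v) (0, h))) (at v)"
    and pos: "((\<lambda>y. F y v) has_derivative (\<lambda>h. F' (x, v) (h, 0))) (at x)"
    if "x \<in> \<Omega>" "v \<noteq> 0" for x v
  proof -
    have z: "((\<lambda>(x, v). F x v) has_derivative blinfun_apply (F' (x, v))) (at (x, v))"
      using F'[of "(x, v)"] that by simp
    show "(F x has_derivative (\<lambda>h. F' (x, v) (0, h))) (at v)"
      using has_derivative_compose[where f = "\<lambda>w. (x, w)" and f' = "\<lambda>h. (0, h)", OF _ z]
      by (simp add: has_derivative_Pair)
    show "((\<lambda>y. F y v) has_derivative (\<lambda>h. F' (x, v) (h, 0))) (at x)"
      using has_derivative_compose[where f = "\<lambda>w. (w, v)" and f' = "\<lambda>h. (h, 0)", OF _ z]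
      by (simp add: has_derivative_Pair)
  qed
  show "(F x has_derivative (\<lambda>h. grad (F x) v \<bullet> h)) (at v)" if "x \<in> \<Omega>" "v \<noteq> 0"
    using dir[OF that] by (intro has_derivative_grad differentiableI)
  show "((\<lambda>y. F y v) has_derivative (\<lambda>h. grad (\<lambda>y. F y v) x \<bullet> h)) (at x)" if "x \<in> \<Omega>" "v \<noteq> 0"
    using pos[OF that] by (intro has_derivative_grad differentiableI)
  have dir': "frechet_derivative (F x) (at v) h = F' (x, v) (0, h)"
    and pos': "frechet_derivative (\<lambda>y. F y v) (at x) h = F' (x, v) (h, 0)"
    if "x \<in> \<Omega>" "v \<noteq> 0" for x v h
    using fun_cong[OF frechet_derivative_at[OF dir[OF that]], of h]
      fun_cong[OF frechet_derivative_at[OF pos[OF that]], of h] by simp_all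
  show "C1_on ?S (\<lambda>(x, v). grad (F x) v)"
    by (rule C1_on_cong_open[OF S C1_on_bounded_linear[OF
            bounded_linear_functional_to_vec[of "\<lambda>i. (0, axis i 1)"] C1]])
      (simp add: case_prod_beta mem_Times_iff grad_def partial_def dir')
  show "C1_on ?S (\<lambda>(x, v). grad (\<lambda>y. F y v) x)"
    by (rule C1_on_cong_open[OF S C1_on_bounded_linear[OF
            bounded_linear_functional_to_vec[of "\<lambda>i. (axis i 1, 0)"] C1]])
      (simp add: case_prod_beta mem_Times_iff grad_def partial_def pos')
qed

text \<open>Euler's identity for one-homogeneous functions.\<close>
lemma grad_inner_self:
  assumes "x \<in> \<Omega>" "w \<noteq> 0"
  shows "grad (F x) w \<bullet> w = F x w"
proof -
  have "((\<lambda>t. F x (t *\<^sub>R w)) has_derivative (\<lambda>d. grad (F x) w \<bullet> (d *\<^sub>R w))) (at 1)"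
    by (rule has_derivative_compose[where f = "\<lambda>t. t *\<^sub>R w"])
      (use has_derivative_direction[OF assms] in \<open>auto intro!: derivative_eq_intros\<close>)
  moreover have "((\<lambda>t. F x (t *\<^sub>R w)) has_derivative (\<lambda>d. d * F x w)) (at 1)"
    by (rule has_derivative_transform_within_open[of "\<lambda>t. t * F x w" _ _ _ "{0<..}"])
      (use F_scale[OF assms(1)] in \<open>auto intro!: derivative_eq_intros\<close>)
  ultimately have "(\<lambda>d. grad (F x) w \<bullet> (d *\<^sub>R w)) = (\<lambda>d. d * F x w)"
    by (rule has_derivative_unique)
  from fun_cong[OF this, of 1] show ?thesis by simp
qed

text \<open>The triangle inequality bounds the forward difference quotients of \<open>F x\<close> in the direction \<open>v\<close> by \<open>F x v\<close>;
  evenness gives the absolute value. Thus the gradient of \<open>F x\<close> lies in the dual unit ball.\<close>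
lemma abs_grad_inner_le:
  assumes "x \<in> \<Omega>" "w \<noteq> 0"
  shows "\<bar>grad (F x) w \<bullet> v\<bar> \<le> F x v"
proof -
  have le: "grad (F x) w \<bullet> v \<le> F x v" for v
  proof -
    have "((\<lambda>t. F x (w + t *\<^sub>R v)) has_derivative (\<lambda>d. grad (F x) w \<bullet> (d *\<^sub>R v))) (at 0)"
      by (rule has_derivative_compose[where f = "\<lambda>t. w + t *\<^sub>R v"])
        (use has_derivative_direction[OF assms] in \<open>auto intro!: derivative_eq_intros\<close>)
    moreover have "(\<lambda>d. grad (F x) w \<bullet> (d *\<^sub>R v)) = (*) (grad (F x) w \<bullet> v)"
      by (simp add: fun_eq_iff)
    ultimately have "((\<lambda>t. F x (w + t *\<^sub>R v)) has_real_derivative (grad (F x) w \<bullet> v)) (at 0)"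
      unfolding has_field_derivative_def by (simp only:)
    then have "((\<lambda>t. (F x (w + t *\<^sub>R v) - F x w) / t) \<longlongrightarrow> grad (F x) w \<bullet> v) (at_right 0)"
      by (simp add: DERIV_def filterlim_at_split)
    moreover have "\<forall>\<^sub>F t in at_right 0. (F x (w + t *\<^sub>R v) - F x w) / t \<le> F x v"
      using eventually_at_right_less[of "0::real"]
    proof eventually_elim
      case (elim t)
      have "F x (w + t *\<^sub>R v) \<le> F x w + t * F x v"
        using F_triangle[OF assms(1), of w "t *\<^sub>R v"] F_scale[OF assms(1), of t v] elim by simp
      then show ?case using elim by (simp add: field_simps)
    qed
    ultimately show ?thesis
      by (rule tendsto_upperbound) simp
  qed
  show ?thesis using le[of v] le[of "- v"] F_minus[OF assms(1)] by (simp add: abs_le_iff)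
qed

text \<open>Euler's identity shows that the bound of \<open>abs_grad_inner_le\<close> is attained in the direction \<open>w\<close>.\<close>
lemma dual_norm_scale_grad:
  assumes "x \<in> \<Omega>" "w \<noteq> 0" "s \<ge> 0"
  shows "dual_norm F x (s *\<^sub>R grad (F x) w) = s"
  unfolding dual_norm_def
proof (rule cSup_eq_maximum)
  have pos: "F x w > 0" using F_pos assms by blast
  define v where "v = (1 / F x w) *\<^sub>R w"
  have "F x v = 1" using F_scale[OF assms(1), of "1 / F x w" w] pos by (simp add: v_def)
  moreover have "v \<bullet> (s *\<^sub>R grad (F x) w) = s"
    using grad_inner_self[OF assms(1,2)] pos by (simp add: v_def inner_commute)
  ultimately show "s \<in> (\<lambda>v. v \<bullet> (s *\<^sub>R grad (F x) w)) ` {v. F x v \<le> 1}"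
    by (intro image_eqI[of _ _ v]) auto
next
  fix y assume "y \<in> (\<lambda>v. v \<bullet> (s *\<^sub>R grad (F x) w)) ` {v. F x v \<le> 1}"
  then obtain v where v: "F x v \<le> 1" "y = s * (grad (F x) w \<bullet> v)" by (auto simp: inner_commute)
  have "grad (F x) w \<bullet> v \<le> 1" using abs_grad_inner_le[OF assms(1,2), of v] v(1) by linarith
  then show "y \<le> s" using v(2) assms(3) by (metis mult_left_mono mult.right_neutral)
qed

text \<open>The divergence of \<open>x \<mapsto> D\<^sub>2F(x, W(x))\<close> by the chain rule. For a gradient
  field of unit length at \<open>p\<close> this is the expression in the definition of an \<open>(m,h)\<close>-set.\<close>
lemma divergence_grad_field:
  assumes "p \<in> \<Omega>" "W p \<noteq> 0"
    and W: "(W has_derivative W') (at p)"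
    and Y: "((\<lambda>x. grad (F x) (W x)) has_derivative Y') (at p)"
  shows "(\<Sum>i\<in>UNIV. Y' (axis i 1) $ i) =
    (\<Sum>i\<in>UNIV. \<Sum>j\<in>UNIV. partial i (partial j (F p)) (W p) * W' (axis j 1) $ i)
      + (\<Sum>i\<in>UNIV. partial i (\<lambda>x. partial i (F x) (W p)) p)"
proof -
  obtain G' where G': "((\<lambda>(x, v). grad (F x) v) has_derivative blinfun_apply G') (at (p, W p))"
    using C1_onE[OF C1_grad_direction] assms(1,2) by (metis (no_types, lifting) DiffI SigmaI UNIV_I singletonD)
  have "((\<lambda>x. grad (F x) (W x)) has_derivative (\<lambda>h. G' (h, W' h))) (at p)"
    using has_derivative_compose[where f = "\<lambda>x. (x, W x)", OF has_derivative_Pair[OF has_derivative_ident W] G']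
    by simp
  then have Y'_eq: "Y' h = G' (h, 0) + G' (0, W' h)" for h
    using has_derivative_unique[OF Y] by (simp flip: blinfun.add_right)
  have "((\<lambda>x. grad (F x) (W p)) has_derivative (\<lambda>h. G' (h, 0))) (at p)"
    using has_derivative_compose[where f = "\<lambda>x. (x, W p)", OF has_derivative_Pair[OF has_derivative_ident has_derivative_const] G']
    by simp
  then have "((\<lambda>x. partial i (F x) (W p)) has_derivative (\<lambda>h. G' (h, 0) $ i)) (at p)" for i
    unfolding grad_def by (drule_tac bounded_linear.has_derivative[OF bounded_linear_vec_nth[of i]]) simp
  then have pos: "partial i (\<lambda>x. partial i (F x) (W p)) p = G' (axis i 1, 0) $ i" for i
    unfolding partial_def[of i "\<lambda>x. partial i (F x) (W p)"] by (metis frechet_derivative_at)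
  have "((\<lambda>v. grad (F p) v) has_derivative (\<lambda>h. G' (0, h))) (at (W p))"
    using has_derivative_compose[where f = "\<lambda>v. (p, v)", OF has_derivative_Pair[OF has_derivative_const has_derivative_ident] G']
    by simp
  then have "((\<lambda>v. partial i (F p) v) has_derivative (\<lambda>h. G' (0, h) $ i)) (at (W p))" for i
    unfolding grad_def by (drule_tac bounded_linear.has_derivative[OF bounded_linear_vec_nth[of i]]) simp
  then have dir: "partial j (partial i (F p)) (W p) = G' (0, axis j 1) $ i" for i j
    unfolding partial_def[of j "partial i (F p)"] by (metis frechet_derivative_at)
  have exp: "G' (0, k) $ i = (\<Sum>j\<in>UNIV. G' (0, axis j 1) $ i * k $ j)" for k i
  proof -
    have "linear (\<lambda>k. G' (0, k) $ i)"
    proof (rule linearI)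
      show "G' (0, k + l) $ i = G' (0, k) $ i + G' (0, l) $ i" for k l
        using blinfun.add_right[of G' "(0, k)" "(0, l)"] by simp
      show "G' (0, c *\<^sub>R k) $ i = c *\<^sub>R (G' (0, k) $ i)" for c k
        using blinfun.scaleR_right[of G' c "(0, k)"] by simp
    qed
    from linear_real_eq_inner[OF this, of k] show ?thesis by (simp add: inner_vec_def)
  qed
  have "Y' (axis i 1) $ i = partial i (\<lambda>x. partial i (F x) (W p)) p
      + (\<Sum>j\<in>UNIV. partial j (partial i (F p)) (W p) * W' (axis i 1) $ j)" for i
    by (simp add: Y'_eq pos dir exp[of "W' (axis i 1)"])
  then have "(\<Sum>i\<in>UNIV. Y' (axis i 1) $ i) = (\<Sum>i\<in>UNIV. partial i (\<lambda>x. partial i (F x) (W p)) p)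
      + (\<Sum>i\<in>UNIV. \<Sum>j\<in>UNIV. partial j (partial i (F p)) (W p) * W' (axis i 1) $ j)"
    by (simp add: sum.distrib)
  moreover have "(\<Sum>i\<in>UNIV. \<Sum>j\<in>UNIV. partial j (partial i (F p)) (W p) * W' (axis i 1) $ j)
      = (\<Sum>i\<in>UNIV. \<Sum>j\<in>UNIV. partial i (partial j (F p)) (W p) * W' (axis j 1) $ i)"
    by (rule sum.swap)
  ultimately show ?thesis by simp
qed

section \<open>The first variation density\<close>

text \<open>The integrand of the first variation at \<open>(x, v)\<close> for a field with value \<open>y\<close> and derivative \<open>L\<close> at \<open>x\<close>.\<close>
definition variation_density ::
    "real ^ 'n \<Rightarrow> real ^ 'n \<Rightarrow> real ^ 'n \<Rightarrow> (real ^ 'n \<Rightarrow> real ^ 'n) \<Rightarrow> real" where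
  "variation_density x v y L = grad (\<lambda>z. F z v) x \<bullet> y
     + F x v * (\<Sum>i\<in>UNIV. L (axis i 1) $ i) - v \<bullet> L (grad (F x) v)"

text \<open>The coefficient of \<open>\<phi>'\<close> in the first variation of a field \<open>\<phi>(g) Y\<close>, where \<open>w\<close> is the gradient of \<open>g\<close>
  and \<open>Y = D\<^sub>2F(x, w)\<close>. For the Euclidean norm \<open>F x v = \<bar>v\<bar>\<close> and unit vectors it is
  \<open>1 - (v \<bullet> w)\<^sup>2\<close>, the squared sine of the angle between \<open>v\<close> and \<open>w\<close>.\<close>
definition tilt_excess :: "real ^ 'n \<Rightarrow> real ^ 'n \<Rightarrow> real ^ 'n \<Rightarrow> real" where
  "tilt_excess x w v = F x v * F x w - (v \<bullet> grad (F x) w) * (grad (F x) v \<bullet> w)"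

lemma variation_density_eq:
  assumes "(X has_derivative L) (at x)"
  shows "grad (\<lambda>y. F y v) x \<bullet> X x + frobenius (B_tensor F x v) (jacobian X (at x))
    = variation_density x v (X x) L"
  using frobenius_B_tensor[OF has_derivative_linear[OF assms], of F x v]
    frechet_derivative_at[OF assms]
  by (simp add: variation_density_def jacobian_def)

lemma variation_density_scale:
  "variation_density x v (s *\<^sub>R y) (\<lambda>h. s *\<^sub>R L h + l h *\<^sub>R y)
    = s * variation_density x v y L + (F x v * (\<Sum>i\<in>UNIV. l (axis i 1) * y $ i) - (v \<bullet> y) * l (grad (F x) v))"
  by (simp add: variation_density_def inner_add_right sum.distrib sum_distrib_left algebra_simps)

lemma continuous_on_F:
  "continuous_on (\<Omega> \<times> (UNIV - {0})) (\<lambda>(x, v). F x v)"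
  "continuous_on (\<Omega> \<times> (UNIV - {0})) (\<lambda>(x, v). grad (F x) v)"
  "continuous_on (\<Omega> \<times> (UNIV - {0})) (\<lambda>(x, v). grad (\<lambda>y. F y v) x)"
  using C1_on_continuous[OF C1_F] C1_on_continuous[OF C1_grad_direction]
    C1_on_continuous[OF C1_grad_position] by auto

lemma continuous_on_F_compose [continuous_intros]:
  assumes "continuous_on S a" "continuous_on S b"
    and "\<And>z. z \<in> S \<Longrightarrow> a z \<in> \<Omega>" "\<And>z. z \<in> S \<Longrightarrow> b z \<noteq> 0"
  shows "continuous_on S (\<lambda>z. F (a z) (b z))"
    and "continuous_on S (\<lambda>z. grad (F (a z)) (b z))"
    and "continuous_on S (\<lambda>z. grad (\<lambda>y. F y (b z)) (a z))"
  using continuous_on_compose2[OF continuous_on_F(1) continuous_on_Pair[OF assms(1,2)]]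
    continuous_on_compose2[OF continuous_on_F(2) continuous_on_Pair[OF assms(1,2)]]
    continuous_on_compose2[OF continuous_on_F(3) continuous_on_Pair[OF assms(1,2)]]
    assms(3,4) by auto

lemma continuous_on_variation_density:
  fixes L :: "real ^ 'n \<Rightarrow> (real ^ 'n) \<Rightarrow>\<^sub>L (real ^ 'n)"
  assumes "continuous_on U y" "continuous_on U L" "U \<subseteq> \<Omega>" "0 \<notin> S"
  shows "continuous_on (U \<times> S) (\<lambda>z. variation_density (fst z) (snd z) (y (fst z)) (L (fst z)))"
proof -
  have y: "continuous_on (U \<times> S) (\<lambda>z. y (fst z))" and L: "continuous_on (U \<times> S) (\<lambda>z. L (fst z))"
    by (rule continuous_on_compose2[OF assms(1) continuous_on_fst[OF continuous_on_id]]
        continuous_on_compose2[OF assms(2) continuous_on_fst[OF continuous_on_id]]; auto)+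
  show ?thesis
    unfolding variation_density_def
    by (intro continuous_intros y L) (use assms(3,4) in auto)
qed

lemma tilt_excess_nonneg:
  assumes "x \<in> \<Omega>" "w \<noteq> 0" "v \<noteq> 0"
  shows "tilt_excess x w v \<ge> 0"
proof -
  have "\<bar>v \<bullet> grad (F x) w\<bar> * \<bar>grad (F x) v \<bullet> w\<bar> \<le> F x v * F x w"
    using abs_grad_inner_le[OF assms(1,2), of v] abs_grad_inner_le[OF assms(1,3), of w]
      F_pos[OF assms(1,3)]
    by (intro mult_mono) (auto simp: inner_commute)
  then show ?thesis
    unfolding tilt_excess_def using abs_le_D1 by (fastforce simp flip: abs_mult)
qed

text \<open>Both factors of the product in \<open>tilt_excess\<close> are bounded by the matching factor of \<open>F x v * F x w\<close>,
  so equality of the products forces equality of the factors.\<close>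
lemma tilt_excess_zero:
  assumes "x \<in> \<Omega>" "w \<noteq> 0" "v \<noteq> 0" "tilt_excess x w v = 0"
  shows "\<bar>v \<bullet> grad (F x) w\<bar> = F x v"
proof (rule antisym)
  show le: "\<bar>v \<bullet> grad (F x) w\<bar> \<le> F x v"
    using abs_grad_inner_le[OF assms(1,2), of v] by (simp add: inner_commute)
  have w: "F x w > 0" using F_pos assms by blast
  have "F x v * F x w = \<bar>v \<bullet> grad (F x) w\<bar> * \<bar>grad (F x) v \<bullet> w\<bar>"
    using assms(4) mult_pos_pos[OF F_pos[OF assms(1,3)] w]
    by (simp add: tilt_excess_def flip: abs_mult)
  also have "\<dots> \<le> \<bar>v \<bullet> grad (F x) w\<bar> * F x w"
    using abs_grad_inner_le[OF assms(1,3), of w] by (intro mult_left_mono) auto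
  finally show "F x v \<le> \<bar>v \<bullet> grad (F x) w\<bar>" using w by simp
qed

text \<open>With \<open>\<sigma>\<close> the sign of \<open>\<langle>v,Y(p)\<rangle>\<close>, the function \<open>F(x,z) - \<sigma> \<langle>z,Y(x)\<rangle>\<close> is nonnegative for \<open>x\<close> near \<open>p\<close> and
  vanishes at \<open>(p,v)\<close>. Criticality in \<open>z\<close> gives \<open>D\<^sub>2F(p,v) = \<sigma> Y(p)\<close>, and criticality in \<open>x\<close> expresses
  \<open>D\<^sub>1F(p,v)\<close> through the derivative of \<open>Y\<close>. Inserting both, everything except the trace term
  cancels.\<close>
lemma variation_density_untilted:
  assumes U: "open U" "U \<subseteq> \<Omega>" "p \<in> U" and W: "\<And>x. x \<in> U \<Longrightarrow> W x \<noteq> 0"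
    and Y: "((\<lambda>x. grad (F x) (W x)) has_derivative L) (at p)"
    and v: "v \<noteq> 0" and tilt: "tilt_excess p (W p) v = 0"
  shows "variation_density p v (grad (F p) (W p)) L = F p v * (\<Sum>i\<in>UNIV. L (axis i 1) $ i)"
proof -
  let ?Y = "\<lambda>x. grad (F x) (W x)"
  have p: "p \<in> \<Omega>" using U by blast
  define \<sigma> where "\<sigma> = sgn (v \<bullet> ?Y p)"
  have eq: "F p v = \<sigma> * (v \<bullet> ?Y p)"
    using tilt_excess_zero[OF p W[OF U(3)] v tilt] by (simp add: \<sigma>_def sgn_mult_abs abs_sgn mult.commute)
  have le: "\<sigma> * (z \<bullet> ?Y x) \<le> F x z" if "x \<in> U" for x z
  proof -
    have "\<sigma> * (z \<bullet> ?Y x) \<le> \<bar>z \<bullet> ?Y x\<bar>"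
      by (auto simp: \<sigma>_def sgn_if)
    also have "\<dots> \<le> F x z"
      using abs_grad_inner_le[of x "W x" z] that U W by (auto simp: inner_commute)
    finally show ?thesis .
  qed
  have dir: "grad (F p) v = \<sigma> *\<^sub>R ?Y p"
  proof -
    have "((\<lambda>z. F p z - \<sigma> * (z \<bullet> ?Y p)) has_derivative (\<lambda>h. grad (F p) v \<bullet> h - \<sigma> * (h \<bullet> ?Y p))) (at v)"
      by (intro derivative_intros has_derivative_direction p v)
    moreover have "\<forall>z\<in>UNIV. F p v - \<sigma> * (v \<bullet> ?Y p) \<le> F p z - \<sigma> * (z \<bullet> ?Y p)"
      using le[OF U(3)] eq by simp
    ultimately have "(\<lambda>h. grad (F p) v \<bullet> h - \<sigma> * (h \<bullet> ?Y p)) = (\<lambda>h. 0)"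
      by (intro differential_zero_maxmin[of v UNIV]) auto
    from fun_cong[OF this] have "(grad (F p) v - \<sigma> *\<^sub>R ?Y p) \<bullet> h = 0" for h
      by (simp add: inner_diff_left inner_diff_right inner_commute)
    from this[of "grad (F p) v - \<sigma> *\<^sub>R ?Y p"] show ?thesis by simp
  qed
  have pos: "grad (\<lambda>x. F x v) p \<bullet> h = \<sigma> * (v \<bullet> L h)" for h
  proof -
    have "((\<lambda>x. F x v - \<sigma> * (v \<bullet> ?Y x)) has_derivative
        (\<lambda>h. grad (\<lambda>x. F x v) p \<bullet> h - \<sigma> * (v \<bullet> L h))) (at p)"
      by (intro derivative_intros has_derivative_position p v Y)
    moreover have "\<forall>x\<in>U. F p v - \<sigma> * (v \<bullet> ?Y p) \<le> F x v - \<sigma> * (v \<bullet> ?Y x)"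
      using le eq by simp
    ultimately have "(\<lambda>h. grad (\<lambda>x. F x v) p \<bullet> h - \<sigma> * (v \<bullet> L h)) = (\<lambda>h. 0)"
      by (intro differential_zero_maxmin[OF U(3,1)]) auto
    from fun_cong[OF this, of h] show ?thesis by simp
  qed
  show ?thesis
    unfolding variation_density_def pos dir
    by (simp add: linear_cmul[OF has_derivative_linear[OF Y]])
qed

text \<open>At \<open>p\<close> the untilted directions contribute \<open>F(p,v) (div Y(p) - h) > 0\<close>, so \<open>compact_penalty\<close> applies
  on the sphere over \<open>p\<close>; continuity, uniform over the compact sphere, extends the bound to a
  neighbourhood of \<open>p\<close>.\<close>
lemma calibration:
  assumes U: "open U" "U \<subseteq> \<Omega>" "p \<in> U"
    and W: "continuous_on U W" "\<And>x. x \<in> U \<Longrightarrow> W x \<noteq> 0"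
    and Y: "\<And>x. x \<in> U \<Longrightarrow> ((\<lambda>x. grad (F x) (W x)) has_derivative blinfun_apply (L x)) (at x)"
    and L: "continuous_on U L"
    and div: "(\<Sum>i\<in>UNIV. L p (axis i 1) $ i) > h"
  obtains N C c where "open N" "p \<in> N" "N \<subseteq> U" "C > 0" "c > 0"
    "\<And>x v. x \<in> N \<Longrightarrow> norm v = 1 \<Longrightarrow> c \<le>
      variation_density x v (grad (F x) (W x)) (L x) - h * F x v + C * tilt_excess x (W x) v"
proof -
  let ?S = "sphere (0 :: real ^ 'n) 1"
  define Q where "Q z = variation_density (fst z) (snd z) (grad (F (fst z)) (W (fst z))) (L (fst z))
      - h * F (fst z) (snd z)" for z
  define P where "P z = tilt_excess (fst z) (W (fst z)) (snd z)" for z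
  have W': "continuous_on (U \<times> ?S) (\<lambda>z. W (fst z))"
    by (rule continuous_on_compose2[OF W(1) continuous_on_fst[OF continuous_on_id]]) auto
  have "continuous_on U (\<lambda>x. grad (F x) (W x))"
    by (intro continuous_intros W(1)) (use U W in auto)
  then have "continuous_on (U \<times> ?S)
      (\<lambda>z. variation_density (fst z) (snd z) (grad (F (fst z)) (W (fst z))) (L (fst z)))"
    by (rule continuous_on_variation_density[OF _ L U(2)]) auto
  then have Q: "continuous_on (U \<times> ?S) Q"
    unfolding Q_def by (intro continuous_intros) (use U in auto)
  have P: "continuous_on (U \<times> ?S) P"
    unfolding P_def tilt_excess_def by (intro continuous_intros W') (use U W in auto)
  have slice: "continuous_on ?S (\<lambda>v. g (p, v))" if "continuous_on (U \<times> ?S) g" for g :: "_ \<Rightarrow> real"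
    by (rule continuous_on_compose2[OF that]) (use U in \<open>auto intro!: continuous_intros\<close>)
  have "\<exists>C c. C > 0 \<and> c > 0 \<and> (\<forall>v\<in>?S. c \<le> Q (p, v) + C * P (p, v))"
  proof (rule compact_penalty[OF compact_sphere slice[OF P] slice[OF Q]])
    fix v assume v: "v \<in> ?S"
    then have v0: "v \<noteq> 0" by auto
    show "P (p, v) \<ge> 0"
      using tilt_excess_nonneg[of p "W p" v] U W v0 by (auto simp: P_def)
    assume "P (p, v) = 0"
    then have "Q (p, v) = F p v * ((\<Sum>i\<in>UNIV. L p (axis i 1) $ i) - h)"
      using variation_density_untilted[OF U W(2) Y[OF U(3)] v0] by (simp add: P_def Q_def algebra_simps)
    also have "\<dots> > 0" using F_pos[of p v] U v0 div by auto
    finally show "Q (p, v) > 0" .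
  qed blast
  then obtain C c where C: "C > 0" "c > 0" and c: "\<And>v. v \<in> ?S \<Longrightarrow> c \<le> Q (p, v) + C * P (p, v)"
    by blast
  have "continuous_on (U \<times> ?S) (\<lambda>z. Q z + C * P z)" by (intro continuous_intros P Q)
  from continuous_on_prod_compactE[OF this compact_sphere U(3), of "c / 2"] C
  obtain X where X: "p \<in> X" "open X"
    "\<forall>x\<in>X \<inter> U. \<forall>v\<in>?S. dist (Q (x, v) + C * P (x, v)) (Q (p, v) + C * P (p, v)) \<le> c / 2"
    by auto
  show thesis
  proof (rule that[of "X \<inter> U" C "c / 2"])
    fix x v :: "real ^ 'n" assume x: "x \<in> X \<inter> U" and "norm v = 1"
    then have v: "v \<in> ?S" by simp
    have "dist (Q (x, v) + C * P (x, v)) (Q (p, v) + C * P (p, v)) \<le> c / 2"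
      using X(3) x v by blast
    then have "c / 2 \<le> Q (x, v) + C * P (x, v)"
      using c[OF v] unfolding dist_real_def by linarith
    then show "c / 2 \<le> variation_density x v (grad (F x) (W x)) (L x) - h * F x v
        + C * tilt_excess x (W x) v"
      by (simp add: Q_def P_def)
  qed (use X U C in auto)
qed

section \<open>The test field\<close>

text \<open>The test field is \<open>X = \<kappa> \<eta> \<phi> Y\<close> with \<open>\<phi> = (f + \<epsilon>)\<^sub>+\<^sup>2\<close>, a cutoff \<open>\<eta>\<close> between the balls of radius
  \<open>a\<close> and \<open>b\<close>, and a normalising constant \<open>\<kappa>\<close>. The set \<open>T\<close> carries the error caused by \<open>D\<eta>\<close>: outside
  the ball of radius \<open>a\<close> the set \<open>Z\<close> lies below the level \<open>-a\<^sup>4\<close> of \<open>f\<close>, so \<open>\<epsilon> < a\<^sup>4\<close> separates it from \<open>T\<close>.\<close>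
lemma cutoff_calibration:
  fixes W :: "real ^ 'n \<Rightarrow> real ^ 'n" and f :: "real ^ 'n \<Rightarrow> real"
  assumes N: "open N" "p \<in> N" "N \<subseteq> \<Omega>"
    and f: "\<And>x. x \<in> N \<Longrightarrow> (f has_derivative (\<lambda>h. W x \<bullet> h)) (at x)" "f p = 0"
    and W: "C1_on N W" "\<And>x. x \<in> N \<Longrightarrow> W x \<noteq> 0"
    and Y: "\<And>x. x \<in> N \<Longrightarrow> ((\<lambda>x. grad (F x) (W x)) has_derivative blinfun_apply (L x)) (at x)"
    and c: "C > 0" "c > 0" "\<And>x v. x \<in> N \<Longrightarrow> norm v = 1 \<Longrightarrow> c \<le>
      variation_density x v (grad (F x) (W x)) (L x) - h * F x v + C * tilt_excess x (W x) v"
    and Z: "\<And>x. x \<in> Z \<inter> N \<Longrightarrow> f x \<le> - (dist p x ^ 4)"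
  obtains X s K T r c' M where "C1_on UNIV X" "C1_on UNIV s"
    "compact K" "K \<subseteq> \<Omega>" "\<And>x. x \<notin> K \<Longrightarrow> X x = 0" "\<And>x. norm (X x) \<le> 1"
    "\<And>x. x \<notin> K \<Longrightarrow> s x = 0" "\<And>x. x \<in> \<Omega> \<Longrightarrow> dual_norm F x (X x) = s x"
    "compact T" "T \<subseteq> \<Omega>" "T \<inter> Z = {}" "r > 0" "cball p r \<subseteq> \<Omega>" "c' > 0" "M \<ge> 0"
    "\<And>x v D. x \<in> \<Omega> \<Longrightarrow> norm v = 1 \<Longrightarrow> (X has_derivative D) (at x) \<Longrightarrow>
      c' * indicator (ball p r) x - M * indicator T x \<le> variation_density x v (X x) D - h * s x * F x v"
proof -
  define Y where "Y x = grad (F x) (W x)" for x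
  have f_cont: "continuous_on N f"
    by (meson f(1) continuous_at_imp_continuous_on has_derivative_continuous)
  have f_near: "\<forall>\<^sub>F x in nhds p. f x \<in> {- d<..<d}" if "d > 0" for d
    using f_cont N that f(2)
    by (intro topological_tendstoD[of f "f p"]) (auto simp: continuous_on_eq_continuous_at isCont_def tendsto_nhds_iff)
  have "\<forall>\<^sub>F x in nhds p. x \<in> N \<and> f x \<in> {- (1 / C)<..<1 / C}"
    using f_near[of "1 / C"] c(1) N by (auto simp: eventually_nhds_in_open intro: eventually_conj)
  then obtain b0 where b0: "b0 > 0" "\<And>x. dist x p < b0 \<Longrightarrow> x \<in> N \<and> f x < 1 / C"
    unfolding eventually_nhds_metric by auto
  define b where "b = b0 / 2"
  define a where "a = b / 2"
  have ab: "0 < a" "a < b" "b < b0" using b0 by (auto simp: a_def b_def)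
  have inN: "x \<in> N" "f x < 1 / C" if "dist p x \<le> b" for x
    using b0(2)[of x] that ab by (auto simp: dist_commute)
  define K where "K = cball p b"
  have K: "compact K" "K \<subseteq> N" "K \<subseteq> \<Omega>" using inN N by (auto simp: K_def)
  \<comment> \<open>The bound \<open>a ^ 4 / 2\<close> keeps the error set off \<open>Z\<close>; the bound \<open>1 / C\<close>, with \<open>f < 1 / C\<close> on the ball, makes
    the profile grow fast enough that \<open>\<phi>' \<ge> C \<phi>\<close>.\<close>
  define \<epsilon> where "\<epsilon> = min (a ^ 4 / 2) (1 / C)"
  have \<epsilon>: "\<epsilon> > 0" "\<epsilon> \<le> 1 / C" "\<epsilon> < a ^ 4"
  proof -
    have "a ^ 4 > 0" "1 / C > 0" using ab c by simp_all
    then show "\<epsilon> > 0" "\<epsilon> \<le> 1 / C" "\<epsilon> < a ^ 4" unfolding \<epsilon>_def by linarith+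
  qed
  obtain \<eta> :: "real ^ 'n \<Rightarrow> real" where \<eta>: "C1_on UNIV \<eta>" "\<And>x. \<eta> x \<ge> 0"
    "\<And>x. dist p x \<le> a \<Longrightarrow> \<eta> x = 1" "\<And>x. dist p x \<ge> b \<Longrightarrow> \<eta> x = 0"
    by (rule C1_cutoff[OF ab(1,2), of p]) blast
  obtain \<eta>' where \<eta>': "\<And>x. (\<eta> has_derivative blinfun_apply (\<eta>' x)) (at x)" "continuous_on UNIV \<eta>'"
    using C1_onE[OF \<eta>(1)] by auto
  define \<phi> where "\<phi> x = sqpos (f x + \<epsilon>)" for x
  define \<phi>' where "\<phi>' x = 2 * max 0 (f x + \<epsilon>)" for x
  have \<phi>: "(\<phi> has_derivative (\<lambda>h. \<phi>' x * (W x \<bullet> h))) (at x)" if "x \<in> N" for x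
    unfolding \<phi>_def \<phi>'_def
    by (rule has_derivative_compose[where f = "\<lambda>x. f x + \<epsilon>", OF _ has_derivative_sqpos])
      (auto intro!: derivative_eq_intros f(1) that)
  have \<phi>_cont: "continuous_on N \<phi>'" unfolding \<phi>'_def by (intro continuous_intros f_cont)
  have C1_\<phi>: "C1_on N \<phi>"
    by (rule C1_onI[OF \<phi>]) (auto intro!: continuous_intros \<phi>_cont C1_on_continuous[OF W(1)])
  have \<phi>_nonneg: "\<phi> x \<ge> 0" "\<phi>' x \<ge> 0" for x by (simp_all add: \<phi>_def \<phi>'_def sqpos_nonneg)
  have \<phi>_growth: "C * \<phi> x \<le> \<phi>' x" if "dist p x \<le> b" for x
  proof -
    have "max 0 (f x + \<epsilon>) \<le> 2 / C" using inN(2)[OF that] \<epsilon>(2) c(1) by simp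
    then have "C * max 0 (f x + \<epsilon>) \<le> C * (2 / C)" using c(1) by (intro mult_left_mono) auto
    then have "C * max 0 (f x + \<epsilon>) \<le> 2" using c(1) by simp
    then have "C * max 0 (f x + \<epsilon>) * max 0 (f x + \<epsilon>) \<le> 2 * max 0 (f x + \<epsilon>)"
      by (rule mult_right_mono) simp
    then show ?thesis by (simp add: \<phi>_def \<phi>'_def sqpos_def power2_eq_square mult.assoc)
  qed
  have C1_Y: "C1_on N Y"
    unfolding Y_def using C1_on_compose[OF C1_grad_direction C1_on_Pair[OF C1_on_ident W(1)]] N W(2)
    by auto
  have Y_cont: "continuous_on K Y" using C1_on_continuous[OF C1_Y] K by (blast intro: continuous_on_subset)
  have \<phi>K: "continuous_on K \<phi>" using C1_on_continuous[OF C1_\<phi>] K by (blast intro: continuous_on_subset)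
  have "bounded ((\<lambda>x. (\<eta> x * \<phi> x) *\<^sub>R Y x) ` K)"
    by (intro compact_imp_bounded compact_continuous_image K continuous_intros Y_cont \<phi>K
        continuous_on_subset[OF C1_on_continuous[OF \<eta>(1)]]) auto
  then obtain B where B: "B > 0" "\<And>x. x \<in> K \<Longrightarrow> norm ((\<eta> x * \<phi> x) *\<^sub>R Y x) \<le> B"
    unfolding bounded_pos by auto
  define \<kappa> where "\<kappa> = 1 / B"
  have \<kappa>: "\<kappa> > 0" using B by (simp add: \<kappa>_def)
  define s0 where "s0 x = \<kappa> * (\<eta> x * \<phi> x)" for x
  define s where "s x = (if x \<in> N then s0 x else 0)" for x
  define X where "X x = (if x \<in> N then s0 x *\<^sub>R Y x else 0)" for x
  have s0_zero: "s0 x = 0" if "x \<notin> K" for x using \<eta>(4)[of x] that by (simp add: s0_def K_def)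
  have s0_nonneg: "s0 x \<ge> 0" for x using \<kappa> \<eta>(2) \<phi>_nonneg by (simp add: s0_def)
  have C1_s0: "C1_on N s0"
    unfolding s0_def
    using C1_on_scaleR[OF C1_on_const C1_on_scaleR[OF C1_on_subset[OF \<eta>(1) subset_UNIV] C1_\<phi>], of \<kappa>] by simp
  have C1_s: "C1_on UNIV s"
    unfolding s_def using s0_zero
    by (intro C1_on_extend_zero[OF N(1) compact_imp_closed[OF K(1)] K(2) C1_s0]) auto
  have C1_X: "C1_on UNIV X"
    unfolding X_def using s0_zero
    by (intro C1_on_extend_zero[OF N(1) compact_imp_closed[OF K(1)] K(2) C1_on_scaleR[OF C1_s0 C1_Y]]) auto
  have X_off: "X x = 0" "s x = 0" if "x \<notin> K" for x using s0_zero[OF that] by (simp_all add: X_def s_def)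
  have X_le: "norm (X x) \<le> 1" for x
  proof (cases "x \<in> K")
    case True
    have "norm (X x) \<le> \<kappa> * norm ((\<eta> x * \<phi> x) *\<^sub>R Y x)"
      using \<kappa> by (simp add: X_def s0_def abs_mult)
    also have "\<dots> \<le> \<kappa> * B" using B(2)[OF True] \<kappa> by (intro mult_left_mono) auto
    also have "\<dots> = 1" using B(1) by (simp add: \<kappa>_def)
    finally show ?thesis .
  qed (simp add: X_off)
  have dual: "dual_norm F x (X x) = s x" if x: "x \<in> \<Omega>" for x
  proof (cases "x \<in> N")
    case True
    then show ?thesis
      using dual_norm_scale_grad[OF x W(2) s0_nonneg] by (simp add: X_def s_def Y_def)
  next
    case False
    then have "X x = 0 *\<^sub>R grad (F x) (W p)" "s x = 0" by (auto simp: X_def s_def)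
    then show ?thesis using dual_norm_scale_grad[OF x W(2)[OF N(2)], of 0] by simp
  qed
  define T where "T = {x \<in> K. a \<le> dist p x \<and> - \<epsilon> \<le> f x}"
  have fK: "continuous_on K f" using f_cont K by (blast intro: continuous_on_subset)
  have "T = K \<inter> (K \<inter> f -` {- \<epsilon>..}) \<inter> - ball p a" by (auto simp: T_def)
  moreover have "closed (K \<inter> f -` {- \<epsilon>..})"
    by (rule continuous_closed_preimage[OF fK compact_imp_closed[OF K(1)]]) simp
  ultimately have T: "compact T"
    using K(1) by (simp only:) (intro compact_Int_closed closed_Compl open_ball; assumption)
  have TZ: "T \<inter> Z = {}"
  proof safe
    fix x assume x: "x \<in> T" "x \<in> Z"
    then have "- \<epsilon> \<le> - (dist p x ^ 4)" using Z[of x] K by (force simp: T_def)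
    moreover have "a ^ 4 \<le> dist p x ^ 4" using x ab by (intro power_mono) (auto simp: T_def)
    ultimately show "x \<in> {}" using \<epsilon>(3) by linarith
  qed
  let ?S = "sphere (0 :: real ^ 'n) 1"
  define E where "E x v = F x v * \<eta>' x (Y x) - (v \<bullet> Y x) * \<eta>' x (grad (F x) v)" for x v
  have fstK: "continuous_on (K \<times> ?S) (\<lambda>z. g (fst z))" if "continuous_on K g"
    for g :: "real ^ 'n \<Rightarrow> 'b::topological_space"
    by (rule continuous_on_compose2[OF that continuous_on_fst[OF continuous_on_id]]) auto
  have "continuous_on (K \<times> ?S) (\<lambda>z. \<phi> (fst z) * E (fst z) (snd z))"
    unfolding E_def
    by (intro continuous_intros fstK[OF \<phi>K] fstK[OF Y_cont] fstK[OF continuous_on_subset[OF \<eta>'(2)]])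
      (use K in auto)
  then have "bounded ((\<lambda>z. \<phi> (fst z) * E (fst z) (snd z)) ` (K \<times> ?S))"
    by (intro compact_imp_bounded compact_continuous_image compact_Times K compact_sphere)
  then obtain M where M: "M > 0" "\<And>x v. x \<in> K \<Longrightarrow> norm v = 1 \<Longrightarrow> \<bar>\<phi> x * E x v\<bar> \<le> M"
    unfolding bounded_pos by auto
  \<comment> \<open>In the ball of radius \<open>a\<close> the cutoff is constant, and below the level \<open>- \<epsilon>\<close> the profile vanishes.\<close>
  have E_le: "- M * indicator T x \<le> \<phi> x * E x v" if x: "x \<in> K" "norm v = 1" for x v
  proof (cases "x \<in> T")
    case True
    then show ?thesis using M(2)[OF x] by simp
  next
    case False
    then consider "dist p x < a" | "f x < - \<epsilon>" using x by (auto simp: T_def)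
    then have "\<phi> x * E x v = 0"
    proof cases
      case 1
      have "(\<eta> has_derivative (\<lambda>h. 0)) (at x)"
        by (rule has_derivative_transform_within_open[OF has_derivative_const[of 1] open_ball[of p a]])
          (use 1 \<eta>(3) in auto)
      then have "blinfun_apply (\<eta>' x) = (\<lambda>h. 0)" using \<eta>'(1) by (blast intro: has_derivative_unique)
      then show ?thesis by (simp add: E_def)
    next
      case 2
      then show ?thesis by (simp add: \<phi>_def sqpos_eq_0)
    qed
    then show ?thesis using False by (metis indicator_simps(2) mult_zero_right order_refl)
  qed
  obtain r0 where r0: "r0 > 0" "\<And>x. dist x p < r0 \<Longrightarrow> - (\<epsilon> / 2) < f x"
    using f_near[of "\<epsilon> / 2"] \<epsilon>(1) unfolding eventually_nhds_metric by auto
  define r where "r = min r0 a"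
  have r: "r > 0" "r \<le> a" using r0 ab by (auto simp: r_def)
  have rK: "cball p r \<subseteq> K" using r ab by (auto simp: K_def)
  define m where "m = (\<epsilon> / 2)\<^sup>2"
  have m: "m * indicator (ball p r) x \<le> \<eta> x * \<phi> x" for x
  proof (cases "x \<in> ball p r")
    case True
    then have "\<epsilon> / 2 \<le> f x + \<epsilon>" using r0(2)[of x] by (auto simp: r_def dist_commute)
    then have "m \<le> \<phi> x" using \<epsilon>(1) by (auto simp: m_def \<phi>_def sqpos_def intro!: power_mono)
    then show ?thesis using True \<eta>(3)[of x] r by simp
  qed (use \<eta>(2) \<phi>_nonneg in auto)
  have main: "\<kappa> * c * m * indicator (ball p r) x - \<kappa> * M * indicator T x
      \<le> variation_density x v (X x) D - h * s x * F x v"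
    if x: "x \<in> \<Omega>" and v: "norm v = 1" and D: "(X has_derivative D) (at x)" for x v D
  proof (cases "x \<in> K")
    case False
    have "(X has_derivative (\<lambda>_. 0)) (at x)"
      by (rule has_derivative_transform_within_open[OF has_derivative_const[of 0] open_Compl[OF compact_imp_closed[OF K(1)]]])
        (use False X_off in auto)
    then have "D = (\<lambda>_. 0)" using D by (blast intro: has_derivative_unique)
    then have "variation_density x v (X x) D = 0" using X_off[OF False] by (simp add: variation_density_def)
    moreover have "x \<notin> ball p r" using False rK ball_subset_cball by blast
    ultimately show ?thesis using X_off[OF False] \<kappa> M(1) by simp
  next
    case True
    then have xN: "x \<in> N" and xb: "dist p x \<le> b" using K by (auto simp: K_def)
    have v0: "v \<noteq> 0" using v by auto
    let ?l = "\<lambda>h. \<kappa> * (\<eta>' x h * \<phi> x + \<eta> x * (\<phi>' x * (W x \<bullet> h)))"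
    have "(s0 has_derivative ?l) (at x)"
      unfolding s0_def using \<eta>'(1)[of x] \<phi>[OF xN]
      by (auto intro!: derivative_eq_intros simp: algebra_simps)
    then have "((\<lambda>x. s0 x *\<^sub>R Y x) has_derivative (\<lambda>h. s0 x *\<^sub>R L x h + ?l h *\<^sub>R Y x)) (at x)"
      by (rule has_derivative_scaleR) (use Y[OF xN] in \<open>simp add: Y_def[abs_def]\<close>)
    then have "(X has_derivative (\<lambda>h. s0 x *\<^sub>R L x h + ?l h *\<^sub>R Y x)) (at x)"
      by (rule has_derivative_transform_within_open[OF _ N(1) xN]) (simp add: X_def)
    then have D_eq: "D = (\<lambda>h. s0 x *\<^sub>R L x h + ?l h *\<^sub>R Y x)"
      by (rule has_derivative_unique[OF D])
    have lin: "linear ?l"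
      by (rule linearI) (simp_all add: blinfun.add_right blinfun.scaleR_right inner_add_right algebra_simps)
    have trace: "(\<Sum>i\<in>UNIV. ?l (axis i 1) * Y x $ i) = ?l (Y x)"
      unfolding linear_real_eq_inner[OF lin, of "Y x"] by (simp add: inner_vec_def)
    have WY: "W x \<bullet> Y x = F x (W x)"
      using grad_inner_self[OF x W(2)[OF xN]] by (simp add: Y_def inner_commute)
    let ?Q = "variation_density x v (Y x) (L x) - h * F x v"
    let ?P = "tilt_excess x (W x) v"
    have "variation_density x v (X x) D
      = s0 x * variation_density x v (Y x) (L x) + (F x v * ?l (Y x) - (v \<bullet> Y x) * ?l (grad (F x) v))"
      unfolding D_eq using variation_density_scale[of x v "s0 x" "Y x" "L x" ?l] trace xN by (simp add: X_def)
    also have "F x v * ?l (Y x) - (v \<bullet> Y x) * ?l (grad (F x) v)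
      = \<kappa> * (\<phi> x * E x v) + \<kappa> * (\<eta> x * (\<phi>' x * ?P))"
      unfolding WY by (simp add: E_def tilt_excess_def Y_def inner_commute[of "W x"] algebra_simps)
    finally have eq: "variation_density x v (X x) D - h * s x * F x v
      = \<kappa> * (\<eta> x * (\<phi> x * ?Q + \<phi>' x * ?P)) + \<kappa> * (\<phi> x * E x v)"
      using xN by (simp add: s_def s0_def algebra_simps)
    \<comment> \<open>The calibration bound, with the factor \<open>C \<phi>\<close> of the tilt excess traded for \<open>\<phi>'\<close>.\<close>
    have "m * indicator (ball p r) x * c \<le> \<eta> x * \<phi> x * c"
      using m[of x] c(2) by (intro mult_right_mono) auto
    also have "\<dots> \<le> \<eta> x * \<phi> x * (?Q + C * ?P)"
      using c(3)[OF xN v] \<eta>(2)[of x] \<phi>_nonneg[of x] by (intro mult_left_mono) (auto simp: Y_def)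
    also have "\<dots> = \<eta> x * (\<phi> x * ?Q + C * \<phi> x * ?P)" by (simp add: algebra_simps)
    also have "\<dots> \<le> \<eta> x * (\<phi> x * ?Q + \<phi>' x * ?P)"
      using \<phi>_growth[OF xb] tilt_excess_nonneg[OF x W(2)[OF xN] v0] \<eta>(2)[of x]
      by (intro mult_left_mono add_left_mono mult_right_mono) auto
    finally have "m * indicator (ball p r) x * c + - M * indicator T x
        \<le> \<eta> x * (\<phi> x * ?Q + \<phi>' x * ?P) + \<phi> x * E x v"
      using E_le[OF True v] by (rule add_mono)
    from mult_left_mono[OF this, of \<kappa>] show ?thesis
      unfolding eq using \<kappa> by (simp add: algebra_simps)
  qed
  show thesis
    by (rule that[OF C1_X C1_s K(1,3) X_off(1) X_le X_off(2) dual T _ TZ r(1) _ _ _ main])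
      (use K rK \<kappa> c \<epsilon> M(1) in \<open>auto simp: T_def m_def\<close>)
qed

end

section \<open>Mass bounds and the first variation integral\<close>

lemma varifold_sets:
  assumes "varifold \<Omega> V"
  shows "space V = \<Omega> \<times> sphere 0 1" "sets V = sets (restrict_space borel (\<Omega> \<times> sphere 0 1))"
    "\<And>K. compact K \<Longrightarrow> K \<subseteq> \<Omega> \<times> sphere 0 1 \<Longrightarrow> emeasure V K < \<infinity>"
  using assms unfolding varifold_def radon_measure_on_def by blast+

lemma measurable_fst_varifold:
  assumes "varifold \<Omega> V"
  shows "fst \<in> measurable V (restrict_space borel \<Omega>)"
proof -
  have "fst \<in> borel_measurable (restrict_space borel (\<Omega> \<times> sphere 0 1))"
    by (intro borel_measurable_continuous_on_restrict continuous_intros)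
  then have "fst \<in> borel_measurable V"
    using varifold_sets(2)[OF assms] by (simp cong: measurable_cong_sets)
  then show ?thesis
    by (rule measurable_restrict_space2[rotated]) (auto simp: varifold_sets(1)[OF assms])
qed

lemma emeasure_weight:
  assumes "varifold \<Omega> V" "A \<in> sets borel" "A \<subseteq> \<Omega>"
  shows "A \<in> sets (weight \<Omega> V)" "fst -` A \<inter> space V \<in> sets V"
    "emeasure (weight \<Omega> V) A = emeasure V (fst -` A \<inter> space V)"
proof -
  have A: "A \<in> sets (restrict_space borel \<Omega>)"
    using assms(2,3) by (auto simp: sets_restrict_space image_iff intro!: bexI[of _ A])
  show "A \<in> sets (weight \<Omega> V)" using A by (simp add: weight_def)
  show "fst -` A \<inter> space V \<in> sets V" by (rule measurable_sets[OF measurable_fst_varifold[OF assms(1)] A])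
  show "emeasure (weight \<Omega> V) A = emeasure V (fst -` A \<inter> space V)"
    unfolding weight_def by (rule emeasure_distr[OF measurable_fst_varifold[OF assms(1)] A])
qed

lemma emeasure_weight_finite:
  assumes "varifold \<Omega> V" "A \<in> sets borel" "A \<subseteq> K" "compact K" "K \<subseteq> \<Omega>"
  shows "emeasure (weight \<Omega> V) A < \<infinity>"
proof -
  have K: "emeasure V (K \<times> sphere 0 1) < \<infinity>"
    by (intro varifold_sets(3)[OF assms(1)] compact_Times assms compact_sphere) (use assms in auto)
  have "fst -` K \<inter> space V = K \<times> sphere 0 1"
    using assms(5) by (auto simp: varifold_sets(1)[OF assms(1)])
  then have "emeasure V (K \<times> sphere 0 1) = emeasure (weight \<Omega> V) K"
    using emeasure_weight(3)[OF assms(1) borel_compact[OF assms(4)] assms(5)] by simp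
  moreover have "emeasure (weight \<Omega> V) A \<le> emeasure (weight \<Omega> V) K"
    by (intro emeasure_mono assms(3) emeasure_weight(1)[OF assms(1)] borel_compact assms)
  ultimately show ?thesis using K by order
qed

text \<open>The Bochner integral of a non-integrable function is 0, so the integrals in the first variation carry
  information only through this integrability.\<close>
lemma varifold_integrable:
  fixes g :: "(real ^ 'n::finite) \<times> (real ^ 'n) \<Rightarrow> real"
  assumes V: "varifold \<Omega> V" and K: "compact K" "K \<subseteq> \<Omega>"
    and g: "continuous_on (\<Omega> \<times> sphere 0 1) g"
    and zero: "\<And>x v. x \<in> \<Omega> - K \<Longrightarrow> norm v = 1 \<Longrightarrow> g (x, v) = 0"
  shows "integrable V g"
proof -
  let ?K = "K \<times> sphere (0 :: real ^ 'n) 1"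
  have cK: "compact ?K" by (intro compact_Times K compact_sphere)
  have "continuous_on ?K g" using g by (rule continuous_on_subset) (use K in auto)
  then have "bounded (g ` ?K)" using cK by (intro compact_imp_bounded compact_continuous_image)
  then obtain B where B: "\<And>z. z \<in> ?K \<Longrightarrow> \<bar>g z\<bar> \<le> B"
    unfolding bounded_iff by auto
  have "g \<in> borel_measurable V"
    using borel_measurable_continuous_on_restrict[OF g] varifold_sets(2)[OF V]
    by (simp cong: measurable_cong_sets)
  moreover have "fst -` K \<inter> space V = ?K"
    using K(2) by (auto simp: varifold_sets(1)[OF V])
  then have "?K \<in> sets V"
    using emeasure_weight(2)[OF V borel_compact[OF K(1)] K(2)] by simp
  moreover have "emeasure V ?K < \<infinity>"
    by (rule varifold_sets(3)[OF V cK]) (use K in auto)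
  ultimately show ?thesis
    by (intro integrableI_bounded_set[where A = ?K and B = B])
      (auto intro!: AE_I2 B zero simp: varifold_sets(1)[OF V])
qed

text \<open>Finitely many balls of eventually bounded mass cover \<open>T\<close>.\<close>
lemma eventually_bounded_off_blowup:
  fixes V :: "nat \<Rightarrow> ((real ^ 'n::finite) \<times> (real ^ 'n)) measure"
  assumes \<Omega>: "open \<Omega>" and V: "\<And>k. varifold \<Omega> (V k)"
    and T: "compact T" "T \<subseteq> \<Omega>" "T \<inter> area_blowup_set \<Omega> V = {}"
  obtains B :: real where "B \<ge> 0" "\<forall>\<^sub>F k in sequentially. emeasure (weight \<Omega> (V k)) T \<le> ennreal B"
proof -
  let ?\<mu> = "\<lambda>k. weight \<Omega> (V k)"
  have "\<exists>r n. r > 0 \<and> (\<forall>\<^sub>F k in sequentially. emeasure (?\<mu> k) (ball x r \<inter> \<Omega>) \<le> of_nat n)"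
    if x: "x \<in> T" for x
  proof -
    have "x \<in> closure \<Omega>" using x T(2) closure_subset by blast
    then obtain r where r: "r > 0" "limsup (\<lambda>k. emeasure (?\<mu> k) (ball x r \<inter> \<Omega>)) \<noteq> \<infinity>"
      using x T(3) unfolding area_blowup_set_def by blast
    then obtain n where "limsup (\<lambda>k. emeasure (?\<mu> k) (ball x r \<inter> \<Omega>)) < of_nat n"
      using ennreal_Ex_less_of_nat by (auto simp: less_top)
    then have "\<forall>\<^sub>F k in sequentially. emeasure (?\<mu> k) (ball x r \<inter> \<Omega>) < of_nat n"
      by (rule Limsup_lessD)
    then show ?thesis using r(1) by (blast intro: eventually_mono less_imp_le)
  qed
  then obtain r n where r: "\<And>x. x \<in> T \<Longrightarrow> r x > 0"
    and n: "\<And>x. x \<in> T \<Longrightarrow> \<forall>\<^sub>F k in sequentially. emeasure (?\<mu> k) (ball x (r x) \<inter> \<Omega>) \<le> of_nat (n x)"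
    by metis
  obtain C where C: "C \<subseteq> T" "finite C" "T \<subseteq> (\<Union>x\<in>C. ball x (r x))"
    by (rule compactE_image[OF T(1), of T "\<lambda>x. ball x (r x)"]) (use r in auto)
  have "\<forall>\<^sub>F k in sequentially. \<forall>x\<in>C. emeasure (?\<mu> k) (ball x (r x) \<inter> \<Omega>) \<le> of_nat (n x)"
    using C n by (intro eventually_ball_finite) auto
  then have "\<forall>\<^sub>F k in sequentially. emeasure (?\<mu> k) T \<le> ennreal (\<Sum>x\<in>C. real (n x))"
  proof eventually_elim
    case (elim k)
    have meas: "ball x (r x) \<inter> \<Omega> \<in> sets (?\<mu> k)" for x
      using \<Omega> by (intro emeasure_weight(1)[OF V]) auto
    have "emeasure (?\<mu> k) T \<le> emeasure (?\<mu> k) (\<Union>x\<in>C. ball x (r x) \<inter> \<Omega>)"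
      using C T(2) meas by (intro emeasure_mono sets.finite_UN) auto
    also have "\<dots> \<le> (\<Sum>x\<in>C. emeasure (?\<mu> k) (ball x (r x) \<inter> \<Omega>))"
      using C(2) meas by (intro emeasure_subadditive_finite) auto
    also have "\<dots> \<le> (\<Sum>x\<in>C. of_nat (n x))" using elim by (intro sum_mono) auto
    also have "\<dots> = ennreal (\<Sum>x\<in>C. real (n x))"
      by (simp add: ennreal_of_nat_eq_real_of_nat sum_ennreal)
    finally show ?case .
  qed
  then show thesis by (rule that[rotated]) (simp add: sum_nonneg)
qed

lemma closedin_area_blowup_set:
  fixes V :: "nat \<Rightarrow> ((real ^ 'n::finite) \<times> (real ^ 'n)) measure"
  assumes \<Omega>: "open \<Omega>" and V: "\<And>k. varifold \<Omega> (V k)"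
  shows "closedin (top_of_set \<Omega>) (area_blowup_set \<Omega> V \<inter> \<Omega>)"
proof -
  let ?Z = "area_blowup_set \<Omega> V"
  have "\<exists>e>0. ball x e \<subseteq> - ?Z" if x: "x \<in> closure \<Omega>" "x \<notin> ?Z" for x
  proof -
    obtain r where r: "r > 0" "limsup (\<lambda>k. emeasure (weight \<Omega> (V k)) (ball x r \<inter> \<Omega>)) \<noteq> \<infinity>"
      using x unfolding area_blowup_set_def by blast
    have "y \<notin> ?Z" if y: "y \<in> ball x (r / 2)" for y
    proof
      assume "y \<in> ?Z"
      then have "limsup (\<lambda>k. emeasure (weight \<Omega> (V k)) (ball y (r / 2) \<inter> \<Omega>)) = \<infinity>"
        using r(1) unfolding area_blowup_set_def by simp
      moreover have sub: "ball y (r / 2) \<inter> \<Omega> \<subseteq> ball x r \<inter> \<Omega>"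
      proof
        fix z assume "z \<in> ball y (r / 2) \<inter> \<Omega>"
        then show "z \<in> ball x r \<inter> \<Omega>" using y dist_triangle[of x z y] by auto
      qed
      have "limsup (\<lambda>k. emeasure (weight \<Omega> (V k)) (ball y (r / 2) \<inter> \<Omega>))
          \<le> limsup (\<lambda>k. emeasure (weight \<Omega> (V k)) (ball x r \<inter> \<Omega>))"
        using \<Omega> by (intro Limsup_mono always_eventually allI emeasure_mono sub emeasure_weight(1)[OF V]) auto
      ultimately show False using r(2) by (simp add: top_unique)
    qed
    then show ?thesis using r(1) by (intro exI[of _ "r / 2"]) auto
  qed
  then have nbhd: "\<exists>e>0. ball x e \<subseteq> - ?Z" if "x \<in> \<Omega> - ?Z" for x
    using that closure_subset by blast
  have "open (\<Omega> - ?Z)"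
    unfolding open_contains_ball
  proof
    fix x assume x: "x \<in> \<Omega> - ?Z"
    obtain d where d: "d > 0" "ball x d \<subseteq> \<Omega>" using x \<Omega> openE by blast
    obtain e where e: "e > 0" "ball x e \<subseteq> - ?Z" using nbhd[OF x] by blast
    have "ball x (min d e) \<subseteq> \<Omega> - ?Z" using d(2) e(2) by auto
    then show "\<exists>e>0. ball x e \<subseteq> \<Omega> - ?Z"
      using d(1) e(1) by (intro exI[of _ "min d e"]) simp
  qed
  then have "openin (top_of_set \<Omega>) (\<Omega> - ?Z)"
    using \<Omega> by (simp add: openin_open_eq)
  then show ?thesis
    by (simp add: closedin_def Diff_Int_distrib2 Diff_Int)
qed

context elliptic_integrand
begin

text \<open>Integrates the pointwise inequality of \<open>cutoff_calibration\<close>.\<close>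
lemma first_variation_lower_bound:
  assumes V: "varifold \<Omega> V" and X: "C1_on UNIV X" and s: "C1_on UNIV s"
    and K: "compact K" "K \<subseteq> \<Omega>" and off: "\<And>x. x \<notin> K \<Longrightarrow> X x = 0" "\<And>x. x \<notin> K \<Longrightarrow> s x = 0"
    and dual: "\<And>x. x \<in> \<Omega> \<Longrightarrow> dual_norm F x (X x) = s x"
    and T: "compact T" "T \<subseteq> \<Omega>" and r: "cball p r \<subseteq> \<Omega>"
    and ineq: "\<And>x v D. x \<in> \<Omega> \<Longrightarrow> norm v = 1 \<Longrightarrow> (X has_derivative D) (at x) \<Longrightarrow>
      c * indicator (ball p r) x - M * indicator T x \<le> variation_density x v (X x) D - h * s x * F x v"
  shows "c * measure (weight \<Omega> V) (ball p r) - M * measure (weight \<Omega> V) T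
    \<le> first_variation F V X - h * (\<integral>(x, v). dual_norm F x (X x) * F x v \<partial>V)"
proof -
  let ?S = "sphere (0 :: real ^ 'n) 1"
  obtain D where D: "\<And>x. (X has_derivative blinfun_apply (D x)) (at x)" "continuous_on UNIV D"
    using C1_onE[OF X] by auto
  define f where "f z = variation_density (fst z) (snd z) (X (fst z)) (D (fst z))" for z
  define g where "g z = s (fst z) * F (fst z) (snd z)" for z
  have spaceV: "space V = \<Omega> \<times> ?S" by (rule varifold_sets(1)[OF V])
  have D_off: "blinfun_apply (D x) = (\<lambda>_. 0)" if "x \<notin> K" for x
  proof -
    have "(X has_derivative (\<lambda>_. 0)) (at x)"
      by (rule has_derivative_transform_within_open[OF has_derivative_const[of 0] open_Compl[OF compact_imp_closed[OF K(1)]]])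
        (use that off in auto)
    with D(1) show ?thesis by (blast intro: has_derivative_unique)
  qed
  have f: "integrable V f"
  proof (rule varifold_integrable[OF V K])
    show "continuous_on (\<Omega> \<times> ?S) f"
      unfolding f_def
      by (rule continuous_on_variation_density[OF continuous_on_subset[OF C1_on_continuous[OF X]]
            continuous_on_subset[OF D(2)]]) auto
    show "f (x, v) = 0" if "x \<in> \<Omega> - K" for x v
      using that off D_off by (simp add: f_def variation_density_def)
  qed
  have g: "integrable V g"
  proof (rule varifold_integrable[OF V K])
    have "continuous_on (\<Omega> \<times> ?S) (\<lambda>z. s (fst z))"
      by (rule continuous_on_compose2[OF C1_on_continuous[OF s] continuous_on_fst[OF continuous_on_id]]) auto
    then show "continuous_on (\<Omega> \<times> ?S) g"
      unfolding g_def by (intro continuous_intros) auto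
    show "g (x, v) = 0" if "x \<in> \<Omega> - K" for x v using that off by (simp add: g_def)
  qed
  have fv: "first_variation F V X = integral\<^sup>L V f"
    unfolding first_variation_def
    by (rule Bochner_Integration.integral_cong[OF refl])
      (auto simp: f_def variation_density_eq[OF D(1)])
  have dn: "(\<integral>(x, v). dual_norm F x (X x) * F x v \<partial>V) = integral\<^sup>L V g"
    by (rule Bochner_Integration.integral_cong[OF refl]) (auto simp: g_def dual spaceV)
  have ind: "integrable V (\<lambda>z. indicator A (fst z) :: real)"
    "(\<integral>z. indicator A (fst z) \<partial>V) = measure (weight \<Omega> V) A"
    if A: "A \<in> sets borel" "A \<subseteq> L" "compact L" "L \<subseteq> \<Omega>" for A L
  proof -
    have A': "A \<subseteq> \<Omega>" using A by blast
    note m = emeasure_weight[OF V A(1) A']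
    have eq: "indicator A (fst z) = (indicator (fst -` A \<inter> space V) z :: real)" if "z \<in> space V" for z
      using that by (simp add: indicator_def)
    have fin: "emeasure V (fst -` A \<inter> space V) < \<infinity>"
      using emeasure_weight_finite[OF V A] m(3) by simp
    have "integrable V (indicator (fst -` A \<inter> space V) :: _ \<Rightarrow> real)"
      using m(2) fin by simp
    then show "integrable V (\<lambda>z. indicator A (fst z) :: real)"
      using eq by (simp cong: Bochner_Integration.integrable_cong)
    have "(\<integral>z. indicator A (fst z) \<partial>V) = (\<integral>z. (indicator (fst -` A \<inter> space V) z :: real) \<partial>V)"
      by (rule Bochner_Integration.integral_cong[OF refl eq])
    also have "\<dots> = measure V (fst -` A \<inter> space V)" using m(2) by simp
    also have "\<dots> = measure (weight \<Omega> V) A" using m(3) by (simp add: measure_def)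
    finally show "(\<integral>z. indicator A (fst z) \<partial>V) = measure (weight \<Omega> V) A" .
  qed
  note B = ind[OF borel_open[OF open_ball] ball_subset_cball compact_cball r]
  note T' = ind[OF borel_compact[OF T(1)] order_refl T]
  have "c * measure (weight \<Omega> V) (ball p r) - M * measure (weight \<Omega> V) T
      = (\<integral>z. c * indicator (ball p r) (fst z) - M * indicator T (fst z) \<partial>V)"
    using B T' by simp
  also have "\<dots> \<le> (\<integral>z. f z - h * g z \<partial>V)"
  proof (rule integral_mono)
    fix z assume "z \<in> space V"
    then show "c * indicator (ball p r) (fst z) - M * indicator T (fst z) \<le> f z - h * g z"
      using ineq[of "fst z" "snd z", OF _ _ D(1)] by (auto simp: spaceV f_def g_def mult.assoc)
  qed (use B T' f g in auto)
  also have "\<dots> = integral\<^sup>L V f - h * integral\<^sup>L V g" using f g by simp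
  finally show ?thesis unfolding fv dn .
qed

end

section \<open>The area blow-up set\<close>

lemma partial_partial_eq:
  fixes f :: "real ^ 'n::finite \<Rightarrow> real"
  assumes "(grad f has_derivative L) (at p)"
  shows "partial i (partial j f) p = L (axis i 1) $ j"
proof -
  have "((\<lambda>x. grad f x $ j) has_derivative (\<lambda>h. L h $ j)) (at p)"
    by (rule bounded_linear.has_derivative[OF bounded_linear_vec_nth assms])
  moreover have "(\<lambda>x. grad f x $ j) = partial j f" by (simp add: grad_def)
  ultimately show ?thesis
    unfolding partial_def[of i "partial j f"] by (simp add: frechet_derivative_at[symmetric])
qed

context elliptic_integrand
begin

text \<open>If \<open>div Y(p) > h\<close>, the test field of \<open>cutoff_calibration\<close> makes the tested quantity at least
  \<open>c' \<parallel>V\<^sub>k\<parallel>(B\<^sub>r(p)) - M \<parallel>V\<^sub>k\<parallel>(T)\<close>. It is bounded above by hypothesis and \<open>\<parallel>V\<^sub>k\<parallel>(T)\<close> is bounded, so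
  \<open>\<parallel>V\<^sub>k\<parallel>(B\<^sub>r(p))\<close> stays bounded, and \<open>p\<close> is not a blow-up point.\<close>
lemma area_blowup_touching:
  fixes V :: "nat \<Rightarrow> ((real ^ 'n) \<times> (real ^ 'n)) measure"
  assumes V: "\<And>k. varifold \<Omega> (V k)"
    and hyp: "\<And>K. compact (closure K) \<Longrightarrow> closure K \<subseteq> \<Omega> \<Longrightarrow>
      limsup (\<lambda>k. SUP X\<in>{X. C1c \<Omega> X \<and> (\<forall>x. norm (X x) \<le> indicator K x)}.
        ereal (first_variation F (V k) X
          - h * (\<integral>(x, v). dual_norm F x (X x) * F x v \<partial>(V k)))) < \<infinity>"
    and U: "open U" "U \<subseteq> \<Omega>" "p \<in> U" "p \<in> area_blowup_set \<Omega> V"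
    and g: "\<And>x. x \<in> U \<Longrightarrow> (g has_derivative (\<lambda>h. W x \<bullet> h)) (at x)" "g p = 0"
    and W: "C1_on U W" "\<And>x. x \<in> U \<Longrightarrow> W x \<noteq> 0"
    and max: "\<And>x. x \<in> area_blowup_set \<Omega> V \<inter> U \<Longrightarrow> g x \<le> - (dist p x ^ 4)"
    and Y: "((\<lambda>x. grad (F x) (W x)) has_derivative D) (at p)"
  shows "(\<Sum>i\<in>UNIV. D (axis i 1) $ i) \<le> h"
proof (rule ccontr)
  assume "\<not> ?thesis"
  then have div: "(\<Sum>i\<in>UNIV. D (axis i 1) $ i) > h" by simp
  have "C1_on U (\<lambda>x. grad (F x) (W x))"
    using C1_on_compose[OF C1_grad_direction C1_on_Pair[OF C1_on_ident W(1)]] U(2) W(2) by auto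
  then obtain L where L: "\<And>x. x \<in> U \<Longrightarrow> ((\<lambda>x. grad (F x) (W x)) has_derivative blinfun_apply (L x)) (at x)"
    "continuous_on U L" by (rule C1_onE) blast
  have "blinfun_apply (L p) = D" by (rule has_derivative_unique[OF L(1)[OF U(3)] Y])
  then have divL: "(\<Sum>i\<in>UNIV. L p (axis i 1) $ i) > h" using div by simp
  obtain N C c where N: "open N" "p \<in> N" "N \<subseteq> U" and Cc: "C > 0" "c > 0"
    and cal: "\<And>x v. x \<in> N \<Longrightarrow> norm v = 1 \<Longrightarrow> c \<le>
      variation_density x v (grad (F x) (W x)) (L x) - h * F x v + C * tilt_excess x (W x) v"
    using calibration[OF U(1-3) C1_on_continuous[OF W(1)] W(2) L divL] by blast
  have N\<Omega>: "N \<subseteq> \<Omega>" using N U by blast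
  obtain X s K T r c' M where X: "C1_on UNIV X" "C1_on UNIV s"
    "compact K" "K \<subseteq> \<Omega>" "\<And>x. x \<notin> K \<Longrightarrow> X x = 0" "\<And>x. norm (X x) \<le> 1"
    "\<And>x. x \<notin> K \<Longrightarrow> s x = 0" "\<And>x. x \<in> \<Omega> \<Longrightarrow> dual_norm F x (X x) = s x"
    and T: "compact T" "T \<subseteq> \<Omega>" "T \<inter> area_blowup_set \<Omega> V = {}"
    and r: "r > 0" "cball p r \<subseteq> \<Omega>" and c': "c' > 0" "M \<ge> 0"
    and ineq: "\<And>x v D. x \<in> \<Omega> \<Longrightarrow> norm v = 1 \<Longrightarrow> (X has_derivative D) (at x) \<Longrightarrow>
      c' * indicator (ball p r) x - M * indicator T x \<le> variation_density x v (X x) D - h * s x * F x v"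
    by (rule cutoff_calibration[OF N(1,2) N\<Omega> g(1) g(2) C1_on_subset[OF W(1) N(3)] W(2) L(1) Cc cal,
          where Z = "area_blowup_set \<Omega> V"]) (use N max in auto)
  let ?\<mu> = "\<lambda>k. weight \<Omega> (V k)"
  let ?J = "\<lambda>k. first_variation F (V k) X - h * (\<integral>(x, v). dual_norm F x (X x) * F x v \<partial>(V k))"
  have lower: "c' * measure (?\<mu> k) (ball p r) - M * measure (?\<mu> k) T \<le> ?J k" for k
    by (rule first_variation_lower_bound[OF V X(1-5,7,8) T(1,2) r(2) ineq])
  have supp: "closure {x. X x \<noteq> 0} \<subseteq> K"
    using X(3,5) by (intro closure_minimal compact_imp_closed) auto
  then have "compact (closure {x. X x \<noteq> 0})"
    using compact_Int_closed[OF X(3), of "closure {x. X x \<noteq> 0}"] by (simp add: Int_absorb1)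
  then have "C1c \<Omega> X"
    unfolding C1c_def using supp X(4) C1_on_subset[OF X(1) subset_UNIV] by blast
  moreover have "norm (X x) \<le> indicator K x" for x using X(5,6) by (cases "x \<in> K") auto
  ultimately have upper: "ereal (?J k) \<le> (SUP X\<in>{X. C1c \<Omega> X \<and> (\<forall>x. norm (X x) \<le> indicator K x)}.
        ereal (first_variation F (V k) X
          - h * (\<integral>(x, v). dual_norm F x (X x) * F x v \<partial>(V k))))" (is "_ \<le> ?S k") for k
    by (intro SUP_upper) blast
  have "limsup ?S < \<infinity>"
    using hyp[of K] X(3,4) by (simp add: compact_imp_closed)
  then obtain n :: nat where "limsup ?S < ereal (real n)" using less_PInf_Ex_of_nat[of "limsup ?S"] by auto
  then have "\<forall>\<^sub>F k in sequentially. ?S k < ereal (real n)" by (rule Limsup_lessD)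
  then have J: "\<forall>\<^sub>F k in sequentially. ?J k \<le> real n"
  proof (rule eventually_mono)
    fix k assume "?S k < ereal (real n)"
    then have "ereal (?J k) \<le> ereal (real n)" using upper[of k] by (meson le_less_trans less_imp_le)
    then show "?J k \<le> real n" by simp
  qed
  obtain B where B: "B \<ge> 0" "\<forall>\<^sub>F k in sequentially. emeasure (?\<mu> k) T \<le> ennreal B"
    by (rule eventually_bounded_off_blowup[OF open_domain V T])
  have "\<forall>\<^sub>F k in sequentially. emeasure (?\<mu> k) (ball p r \<inter> \<Omega>) \<le> ennreal ((real n + M * B) / c')"
    using J B(2)
  proof eventually_elim
    case (elim k)
    have "measure (?\<mu> k) T \<le> B"
      using elim(2) B(1) by (simp add: measure_def enn2real_leI)
    then have "M * measure (?\<mu> k) T \<le> M * B" using c'(2) by (rule mult_left_mono)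
    then have "c' * measure (?\<mu> k) (ball p r) \<le> real n + M * B"
      using lower[of k] elim(1) by linarith
    then have m: "measure (?\<mu> k) (ball p r) \<le> (real n + M * B) / c'"
      using c'(1) by (simp add: field_simps)
    have "emeasure (?\<mu> k) (ball p r) < \<infinity>"
      by (rule emeasure_weight_finite[OF V _ ball_subset_cball compact_cball r(2)]) simp
    then have "emeasure (?\<mu> k) (ball p r) = ennreal (measure (?\<mu> k) (ball p r))"
      by (intro emeasure_eq_ennreal_measure) auto
    moreover have "ball p r \<inter> \<Omega> = ball p r" using r(2) ball_subset_cball by blast
    ultimately show ?case using m by (simp add: ennreal_leI)
  qed
  then have "limsup (\<lambda>k. emeasure (?\<mu> k) (ball p r \<inter> \<Omega>)) \<le> ennreal ((real n + M * B) / c')"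
    by (rule Limsup_bounded)
  moreover have "limsup (\<lambda>k. emeasure (?\<mu> k) (ball p r \<inter> \<Omega>)) = \<infinity>"
    using U(4) r(1) unfolding area_blowup_set_def by blast
  ultimately show False by (simp add: top_unique)
qed

text \<open>Dividing \<open>f\<close> by \<open>\<bar>Df(p)\<bar>\<close> makes the gradient at \<open>p\<close> equal to \<open>u\<close>, the point at which the statement
  evaluates the derivatives of \<open>F\<close>. The quartic term makes the maximum strict and leaves the
  gradient and Hessian at \<open>p\<close> unchanged.\<close>
lemma area_blowup_mh_inequality:
  fixes V :: "nat \<Rightarrow> ((real ^ 'n) \<times> (real ^ 'n)) measure"
  assumes V: "\<And>k. varifold \<Omega> (V k)"
    and hyp: "\<And>K. compact (closure K) \<Longrightarrow> closure K \<subseteq> \<Omega> \<Longrightarrow>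
      limsup (\<lambda>k. SUP X\<in>{X. C1c \<Omega> X \<and> (\<forall>x. norm (X x) \<le> indicator K x)}.
        ereal (first_variation F (V k) X
          - h * (\<integral>(x, v). dual_norm F x (X x) * F x v \<partial>(V k)))) < \<infinity>"
    and f: "C2_on \<Omega> f" and p: "p \<in> \<Omega>" "p \<in> area_blowup_set \<Omega> V"
    and e: "e > 0" "\<And>y. y \<in> area_blowup_set \<Omega> V \<inter> \<Omega> \<inter> ball p e \<Longrightarrow> f y \<le> f p"
    and grad: "grad f p \<noteq> 0"
    and u: "u = grad f p /\<^sub>R norm (grad f p)"
  shows "(\<Sum>i\<in>UNIV. \<Sum>j\<in>UNIV. partial i (partial j (F p)) u * partial i (partial j f) p)
          + (\<Sum>i\<in>UNIV. partial i (\<lambda>x. partial i (F x) u) p) * norm (grad f p)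
          \<le> h * norm (grad f p)"
proof -
  define n where "n = norm (grad f p)"
  have n: "n > 0" using grad by (simp add: n_def)
  note Df = C2_on_grad[OF open_domain f]
  have f': "(f has_derivative (\<lambda>h. grad f x \<bullet> h)) (at x)" if "x \<in> \<Omega>" for x
    by (rule has_derivative_grad[OF Df(2)[OF that]])
  obtain H where H: "\<And>x. x \<in> \<Omega> \<Longrightarrow> (grad f has_derivative blinfun_apply (H x)) (at x)"
    "continuous_on \<Omega> H" using C1_onE[OF Df(1)] by blast
  \<comment> \<open>The chain rule produces the Hessian entries of \<open>f\<close> in transposed order.\<close>
  have Hess: "H p (axis j 1) $ i = partial i (partial j f) p" for i j
    using second_derivative_symmetric[OF open_domain p(1) f' H, of "axis j 1" "axis i 1"]
    by (simp add: partial_partial_eq[OF H(1)[OF p(1)]] inner_axis)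
  define g where "g x = (f x - f p) / n - ((x - p) \<bullet> (x - p))\<^sup>2" for x
  define W where "W x = (1 / n) *\<^sub>R grad f x - (4 * ((x - p) \<bullet> (x - p))) *\<^sub>R (x - p)" for x
  have g_eq: "g x = (f x - f p) / n - dist p x ^ 4" for x
  proof -
    have "(x - p) \<bullet> (x - p) = (dist p x)\<^sup>2"
      by (metis dist_commute dist_norm power2_norm_eq_inner)
    then show ?thesis by (simp add: g_def)
  qed
  have g': "(g has_derivative (\<lambda>h. W x \<bullet> h)) (at x)" if "x \<in> \<Omega>" for x
  proof -
    have "((\<lambda>x. ((x - p) \<bullet> (x - p))\<^sup>2) has_derivative (\<lambda>h. 4 * ((x - p) \<bullet> (x - p)) * ((x - p) \<bullet> h))) (at x)"
      by (auto intro!: derivative_eq_intros simp: inner_commute)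
    moreover have "((\<lambda>x. (f x - f p) / n) has_derivative (\<lambda>h. (grad f x \<bullet> h) / n)) (at x)"
      using f'[OF that] n by (auto intro!: derivative_eq_intros)
    ultimately show ?thesis
      unfolding g_def W_def by (drule_tac has_derivative_diff) (auto simp: inner_diff_left)
  qed
  have "C1_on \<Omega> (\<lambda>x. (4 * ((x - p) \<bullet> (x - p))) *\<^sub>R (x - p))"
  proof (rule C1_onI)
    show "((\<lambda>x. (4 * ((x - p) \<bullet> (x - p))) *\<^sub>R (x - p)) has_derivative
        (\<lambda>h. (4 * ((x - p) \<bullet> (x - p))) *\<^sub>R h + (8 * ((x - p) \<bullet> h)) *\<^sub>R (x - p))) (at x)" for x
      by (auto intro!: derivative_eq_intros simp: inner_commute)
  qed (intro continuous_intros)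
  then have W_C1: "C1_on \<Omega> W"
    unfolding W_def by (rule C1_on_diff[OF C1_on_scaleR[OF C1_on_const Df(1)]])
  have Wp: "W p = u" by (simp add: W_def u n_def divide_inverse)
  have W': "(W has_derivative (\<lambda>h. (1 / n) *\<^sub>R H p h)) (at p)"
    unfolding W_def by (auto intro!: derivative_eq_intros H(1) p)
  have u0: "u \<noteq> 0" using grad by (simp add: u)
  define U where "U = {x \<in> \<Omega>. W x \<in> - {0}} \<inter> ball p e"
  have "open {x \<in> \<Omega>. W x \<in> - {0}}"
    using continuous_open_preimage[OF C1_on_continuous[OF W_C1] open_domain, of "- {0}"]
    by (simp add: vimage_def Int_def open_Compl)
  then have U: "open U" "U \<subseteq> \<Omega>" "p \<in> U"
    using p(1) e(1) Wp u0 by (auto simp: U_def)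
  have UW: "W x \<noteq> 0" if "x \<in> U" for x using that by (simp add: U_def)
  have max: "g x \<le> - (dist p x ^ 4)" if "x \<in> area_blowup_set \<Omega> V \<inter> U" for x
  proof -
    have "f x \<le> f p" using e(2)[of x] that by (auto simp: U_def)
    then show ?thesis using n by (simp add: g_eq divide_le_0_iff)
  qed
  have "C1_on U (\<lambda>x. grad (F x) (W x))"
    using C1_on_compose[OF C1_grad_direction C1_on_Pair[OF C1_on_ident C1_on_subset[OF W_C1 U(2)]]] U(2) UW
    by auto
  then obtain D where D: "((\<lambda>x. grad (F x) (W x)) has_derivative D) (at p)"
    using U(3) by (metis C1_onE)
  have le: "(\<Sum>i\<in>UNIV. D (axis i 1) $ i) \<le> h"
    by (rule area_blowup_touching[OF V hyp U p(2) g' _ C1_on_subset[OF W_C1 U(2)] UW max D])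
      (use U in \<open>auto simp: g_def\<close>)
  have div: "(\<Sum>i\<in>UNIV. D (axis i 1) $ i) =
      (\<Sum>i\<in>UNIV. \<Sum>j\<in>UNIV. partial i (partial j (F p)) u * ((1 / n) * partial i (partial j f) p))
      + (\<Sum>i\<in>UNIV. partial i (\<lambda>x. partial i (F x) u) p)"
    using divergence_grad_field[OF p(1) _ W' D] u0 by (simp add: Wp Hess)
  have scale: "\<dots> * n =
      (\<Sum>i\<in>UNIV. \<Sum>j\<in>UNIV. partial i (partial j (F p)) u * partial i (partial j f) p)
      + (\<Sum>i\<in>UNIV. partial i (\<lambda>x. partial i (F x) u) p) * n"
    using n by (simp add: distrib_right sum_distrib_right)
  show ?thesis
    using mult_right_mono[OF le less_imp_le[OF n]] unfolding div scale unfolding n_def .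
qed

end

theorem theorem3p4:
  fixes \<Omega> :: "(real ^ 'n::finite) set"
    and F :: "real ^ 'n \<Rightarrow> real ^ 'n \<Rightarrow> real"
    and V :: "nat \<Rightarrow> ((real ^ 'n) \<times> (real ^ 'n)) measure"
    and h :: real
  assumes "open \<Omega>"
    and "anisotropic_integrand \<Omega> F"
    and "\<And>k. varifold \<Omega> (V k)"
    and "h > 0"
    and "\<And>K. compact (closure K) \<Longrightarrow> closure K \<subseteq> \<Omega> \<Longrightarrow>
      limsup (\<lambda>k. SUP X\<in>{X. C1c \<Omega> X \<and> (\<forall>x. norm (X x) \<le> indicator K x)}.
        ereal (first_variation F (V k) X
          - h * (\<integral>(x, v). dual_norm F x (X x) * F x v \<partial>(V k)))) < \<infinity>"
  shows "mh_set \<Omega> F h (area_blowup_set \<Omega> V \<inter> \<Omega>)"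
proof -
  interpret elliptic_integrand \<Omega> F using assms(1,2) by unfold_locales
  show ?thesis
    unfolding mh_set_def Let_def
    by (intro conjI allI impI closedin_area_blowup_set assms(1,3))
      (elim conjE exE IntE, rule area_blowup_mh_inequality[OF assms(3,5)], auto)
qed

end
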